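(* The relation $\approx$ on $\mathcal{K}_1$ (i.e. the set of pairs of closed terms $(s,t)$ over $\mathcal{K}_1$, coded effectively by natural numbers, such that $s\approx t$) is $\Pi^1_1$-complete.
   Context: A partial applicative structure is a set $\mathcal{A}$ with a partial binary operation (application) $(a,b)\mapsto ab$; application associates to the left. Closed terms over $\mathcal{A}$ are built from elements of $\mathcal{A}$ by application; a closed term is defined if all its subterms are defined. For closed terms, $s \simeq t$ means either both are undefined, or both are defined with the same value. For a pca $\mathcal{A}$ define relations $\sim_\alpha$ on closed terms for all ordinals $\alpha$: $s\sim_0 t$ iff $s\simeq t$; $s \sim_{\alpha+1} t$ iff $sx \sim_\alpha tx$ for all $x\in\mathcal{A}$; for limit $\alpha$, $s\sim_\alpha t$ iff $s\sim_\beta t$ for some $\beta<\alpha$. Write $s\approx t$ iff $s\sim_\gamma t$ for some ordinal $\gamma$. Kleene's first model $\mathcal{K}_1$ is the pca with underlying set $\omega$ and application $n\cdot m = \Phi_n(m)$, where $\Phi_n$ is the $n$-th partial computable function. *)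

theory Defs
  imports Main "HOL-Library.Nat_Bijection"
begin

section \<open>Closed terms over a partial applicative structure\<close>

text \<open>
  A partial applicative structure on the type \<open>'a\<close> is a function
  \<open>app :: 'a \<Rightarrow> 'a \<Rightarrow> 'a option\<close>, where \<open>None\<close> stands for ``undefined''.
\<close>

datatype 'a cterm = Elem 'a | App "'a cterm" "'a cterm"

primrec val :: "('a \<Rightarrow> 'a \<Rightarrow> 'a option) \<Rightarrow> 'a cterm \<Rightarrow> 'a option" where
  "val app (Elem a) = Some a"
| "val app (App s t) =
     (case (val app s, val app t) of (Some a, Some b) \<Rightarrow> app a b | _ \<Rightarrow> None)"

definition kleene_eq :: "('a \<Rightarrow> 'a \<Rightarrow> 'a option) \<Rightarrow> 'a cterm \<Rightarrow> 'a cterm \<Rightarrow> bool" where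
  "kleene_eq app s t \<longleftrightarrow> val app s = val app t"


section \<open>The relations indexed by ordinals\<close>

text \<open>
  Ordinals are represented by the elements of (the field of) a well-order \<open>r\<close>: an element
  \<open>\<alpha>\<close> stands for the order type of \<open>underS r \<alpha>\<close>.
\<close>

definition wo_zero :: "'o rel \<Rightarrow> 'o \<Rightarrow> bool" where
  "wo_zero r \<alpha> \<longleftrightarrow> \<alpha> \<in> Field r \<and> underS r \<alpha> = {}"

definition wo_succ :: "'o rel \<Rightarrow> 'o \<Rightarrow> 'o \<Rightarrow> bool" where  \<comment> \<open>\<open>\<alpha> = \<beta> + 1\<close>\<close>
  "wo_succ r \<beta> \<alpha> \<longleftrightarrow> \<beta> \<in> Field r \<and> \<alpha> \<in> Field r \<and> underS r \<alpha> = under r \<beta>"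

definition wo_limit :: "'o rel \<Rightarrow> 'o \<Rightarrow> bool" where
  "wo_limit r \<alpha> \<longleftrightarrow> \<alpha> \<in> Field r \<and> underS r \<alpha> \<noteq> {} \<and> (\<nexists>\<beta>. wo_succ r \<beta> \<alpha>)"

text \<open>
  For a given \<open>\<alpha>\<close> exactly one of the three clauses applies, so the inductive definition
  amounts to the transfinite recursion \<open>sim_zero_iff\<close>, \<open>sim_succ_iff\<close>, \<open>sim_limit_iff\<close> below.
\<close>

inductive sim ::
  "('a \<Rightarrow> 'a \<Rightarrow> 'a option) \<Rightarrow> 'o rel \<Rightarrow> 'o \<Rightarrow> 'a cterm \<Rightarrow> 'a cterm \<Rightarrow> bool"
  for app r where
  sim_zero: "wo_zero r \<alpha> \<Longrightarrow> kleene_eq app s t \<Longrightarrow> sim app r \<alpha> s t"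
| sim_succ: "wo_succ r \<beta> \<alpha> \<Longrightarrow> (\<And>x. sim app r \<beta> (App s (Elem x)) (App t (Elem x)))
              \<Longrightarrow> sim app r \<alpha> s t"
| sim_limit: "wo_limit r \<alpha> \<Longrightarrow> \<beta> \<in> underS r \<alpha> \<Longrightarrow> sim app r \<beta> s t \<Longrightarrow> sim app r \<alpha> s t"

lemma wo_succ_inj:
  assumes "Well_order r" "wo_succ r \<beta> \<alpha>" "wo_succ r \<gamma> \<alpha>"
  shows "\<beta> = \<gamma>"
proof -
  have anti: "antisym r" and re: "refl_on (Field r) r"
    using assms(1) by (auto simp: order_on_defs)
  have "under r \<beta> = under r \<gamma>" "\<beta> \<in> Field r" "\<gamma> \<in> Field r"
    using assms(2,3) by (auto simp: wo_succ_def)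
  moreover from this have "(\<beta>, \<beta>) \<in> r" "(\<gamma>, \<gamma>) \<in> r"
    using re by (auto dest: refl_onD)
  ultimately have "(\<beta>, \<gamma>) \<in> r" "(\<gamma>, \<beta>) \<in> r"
    by (auto simp: under_def)
  then show ?thesis
    using anti by (auto dest: antisymD)
qed

lemma wo_succ_underS:
  assumes "Well_order r" "wo_succ r \<beta> \<alpha>"
  shows "\<beta> \<in> underS r \<alpha>"
proof -
  have "refl_on (Field r) r"
    using assms(1) by (auto simp: order_on_defs)
  then have "(\<beta>, \<beta>) \<in> r"
    using assms(2) by (auto simp: wo_succ_def dest: refl_onD)
  then show ?thesis
    using assms(2) by (auto simp: wo_succ_def under_def)
qed

lemma wo_cases:
  assumes "\<alpha> \<in> Field r"
  obtains "wo_zero r \<alpha>" | \<beta> where "wo_succ r \<beta> \<alpha>" | "wo_limit r \<alpha>"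
  using assms by (auto simp: wo_zero_def wo_limit_def)

lemma sim_zero_iff:
  assumes "Well_order r" "wo_zero r \<alpha>"
  shows "sim app r \<alpha> s t \<longleftrightarrow> kleene_eq app s t"
proof
  assume "sim app r \<alpha> s t"
  then show "kleene_eq app s t"
    by cases (use assms wo_succ_underS in \<open>fastforce simp: wo_zero_def wo_limit_def\<close>)+
qed (use assms in \<open>auto intro: sim_zero\<close>)

lemma sim_succ_iff:
  assumes "Well_order r" "wo_succ r \<beta> \<alpha>"
  shows "sim app r \<alpha> s t \<longleftrightarrow> (\<forall>x. sim app r \<beta> (App s (Elem x)) (App t (Elem x)))"
proof
  assume "sim app r \<alpha> s t"
  then show "\<forall>x. sim app r \<beta> (App s (Elem x)) (App t (Elem x))"
  proof cases
    case sim_zero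
    then show ?thesis
      using wo_succ_underS[OF assms] by (auto simp: wo_zero_def)
  next
    case (sim_succ \<gamma>)
    then show ?thesis
      using wo_succ_inj[OF assms sim_succ(1)] by auto
  next
    case sim_limit
    then show ?thesis
      using assms(2) by (auto simp: wo_limit_def)
  qed
qed (use assms in \<open>auto intro: sim_succ\<close>)

lemma sim_limit_iff:
  assumes "wo_limit r \<alpha>"
  shows "sim app r \<alpha> s t \<longleftrightarrow> (\<exists>\<beta> \<in> underS r \<alpha>. sim app r \<beta> s t)"
proof
  assume "sim app r \<alpha> s t"
  then show "\<exists>\<beta> \<in> underS r \<alpha>. sim app r \<beta> s t"
    by cases (use assms in \<open>auto simp: wo_zero_def wo_limit_def\<close>)
qed (use assms in \<open>auto intro: sim_limit\<close>)

text \<open>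
  HOL has no type of all ordinals. The ordinals ranged over here are those represented by
  elements of well-orders on subsets of the type \<open>'o\<close>; for infinite \<open>'o\<close> these are exactly
  the ordinals of cardinality at most that of \<open>'o\<close>, in particular all countable ones.
\<close>

definition ext_equiv ::
  "'o itself \<Rightarrow> ('a \<Rightarrow> 'a \<Rightarrow> 'a option) \<Rightarrow> 'a cterm \<Rightarrow> 'a cterm \<Rightarrow> bool" where
  "ext_equiv (_ :: 'o itself) app s t \<longleftrightarrow>
     (\<exists>(r :: 'o rel) \<gamma>. Well_order r \<and> \<gamma> \<in> Field r \<and> sim app r \<gamma> s t)"


section \<open>Partial computable functions and Kleene's first model\<close>

text \<open>
  Programs for the unary partial recursive functions, with pairs coded by \<open>prod_encode\<close>.
  \<open>PRec c d\<close> is primitive recursion with a parameter and \<open>Mu c\<close> is unbounded minimisation;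
  \<open>Mu\<close> only converges if all earlier values are defined (and nonzero).
\<close>

datatype prog = Zero | Succ | Fst | Snd
  | Pair prog prog | Comp prog prog | PRec prog prog | Mu prog

definition minimise :: "(nat \<Rightarrow> nat option) \<Rightarrow> nat option" where
  "minimise g =
     (if \<exists>n. g n = Some 0 \<and> (\<forall>m<n. g m \<noteq> None)
      then Some (LEAST n. g n = Some 0) else None)"

primrec run :: "prog \<Rightarrow> nat \<Rightarrow> nat option" where
  "run Zero x = Some 0"
| "run Succ x = Some (Suc x)"
| "run Fst x = Some (fst (prod_decode x))"
| "run Snd x = Some (snd (prod_decode x))"
| "run (Pair c d) x =
     (case (run c x, run d x) of (Some a, Some b) \<Rightarrow> Some (prod_encode (a, b)) | _ \<Rightarrow> None)"
| "run (Comp c d) x = Option.bind (run d x) (run c)"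
| "run (PRec c d) x =
     (case prod_decode x of (a, n) \<Rightarrow>
        rec_nat (run c a)
          (\<lambda>k v. Option.bind v (\<lambda>b. run d (prod_encode (a, prod_encode (k, b))))) n)"
| "run (Mu c) x = minimise (\<lambda>n. run c (prod_encode (x, n)))"

primrec prog_encode :: "prog \<Rightarrow> nat" where
  "prog_encode Zero = 0"
| "prog_encode Succ = 1"
| "prog_encode Fst = 2"
| "prog_encode Snd = 3"
| "prog_encode (Pair c d) = 4 + 4 * prod_encode (prog_encode c, prog_encode d)"
| "prog_encode (Comp c d) = 5 + 4 * prod_encode (prog_encode c, prog_encode d)"
| "prog_encode (PRec c d) = 6 + 4 * prod_encode (prog_encode c, prog_encode d)"
| "prog_encode (Mu c) = 7 + 4 * prog_encode c"

lemma prog_encode_inj: "prog_encode c = prog_encode d \<Longrightarrow> c = d"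
proof (induction c arbitrary: d)
  case Zero
  then show ?case by (cases d) auto
next
  case Succ
  then show ?case by (cases d) auto
next
  case Fst
  then show ?case by (cases d) auto
next
  case Snd
  then show ?case by (cases d) auto
next
  case (Pair c1 c2)
  then show ?case by (cases d) (auto, presburger+)
next
  case (Comp c1 c2)
  then show ?case by (cases d) (auto, presburger+)
next
  case (PRec c1 c2)
  then show ?case by (cases d) (auto, presburger+)
next
  case (Mu c)
  then show ?case by (cases d) (auto, presburger+)
qed

lemma prog_encode_surj: "\<exists>c. prog_encode c = n"
proof (induction n rule: less_induct)
  case (less n)
  show ?case
  proof (cases "n < 4")
    case True
    then have "n = 0 \<or> n = 1 \<or> n = 2 \<or> n = 3" by auto
    then show ?thesis
      by (metis prog_encode.simps(1-4))
  next
    case False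
    define q where "q = (n - 4) div 4"
    obtain a b where ab: "q = prod_encode (a, b)"
      by (metis prod.collapse prod_decode_inverse)
    have "q < n" using False by (simp add: q_def)
    moreover have "a \<le> q" "b \<le> q"
      by (simp_all add: ab le_prod_encode_1 le_prod_encode_2)
    ultimately obtain c d e where
      "prog_encode c = a" "prog_encode d = b" "prog_encode e = q"
      by (meson le_less_trans less)
    moreover have "n = 4 + 4 * q \<or> n = 5 + 4 * q \<or> n = 6 + 4 * q \<or> n = 7 + 4 * q"
      using False by (simp add: q_def) presburger
    ultimately show ?thesis
      by (metis ab prog_encode.simps(5-8))
  qed
qed

lemma bij_prog_encode: "bij prog_encode"
  by (metis bij_def injI prog_encode_inj prog_encode_surj surjI surj_def)

definition Phi :: "nat \<Rightarrow> nat \<Rightarrow> nat option" where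
  "Phi n = run (inv prog_encode n)"

abbreviation K1 :: "nat \<Rightarrow> nat \<Rightarrow> nat option" where
  "K1 \<equiv> Phi"

definition computable :: "(nat \<Rightarrow> nat) \<Rightarrow> bool" where
  "computable h \<longleftrightarrow> (\<exists>e. \<forall>x. Phi e x = Some (h x))"

primrec cterm_encode :: "nat cterm \<Rightarrow> nat" where
  "cterm_encode (Elem n) = 2 * n"
| "cterm_encode (App s t) = 2 * prod_encode (cterm_encode s, cterm_encode t) + 1"


section \<open>\<open>\<Pi>\<^sup>1\<^sub>1\<close> sets\<close>

text \<open>
  The language of arithmetic with one unary function variable, written \<open>Fun\<close>;
  quantifiers range over natural numbers only.
\<close>

datatype aterm = Var nat | Null | TSuc aterm | Add aterm aterm | Mult aterm aterm | Fun aterm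

datatype aform = Eq aterm aterm | Neg aform | Conj aform aform | Forall nat aform

primrec tval :: "(nat \<Rightarrow> nat) \<Rightarrow> (nat \<Rightarrow> nat) \<Rightarrow> aterm \<Rightarrow> nat" where
  "tval f e (Var i) = e i"
| "tval f e Null = 0"
| "tval f e (TSuc t) = tval f e t + 1"
| "tval f e (Add t u) = tval f e t + tval f e u"
| "tval f e (Mult t u) = tval f e t * tval f e u"
| "tval f e (Fun t) = f (tval f e t)"

primrec sat :: "(nat \<Rightarrow> nat) \<Rightarrow> (nat \<Rightarrow> nat) \<Rightarrow> aform \<Rightarrow> bool" where
  "sat f e (Eq t u) \<longleftrightarrow> tval f e t = tval f e u"
| "sat f e (Neg p) \<longleftrightarrow> \<not> sat f e p"
| "sat f e (Conj p q) \<longleftrightarrow> sat f e p \<and> sat f e q"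
| "sat f e (Forall i p) \<longleftrightarrow> (\<forall>m. sat f (e(i := m)) p)"

text \<open>
  A set is \<open>\<Pi>\<^sup>1\<^sub>1\<close> if it is defined by a formula consisting of a universal function quantifier
  followed by an arithmetical formula. The free number variable is \<open>Var 0\<close>; any other free
  variable has the value \<open>0\<close> and could be replaced by \<open>Null\<close>.
\<close>

definition Pi11 :: "nat set \<Rightarrow> bool" where
  "Pi11 A \<longleftrightarrow> (\<exists>p. \<forall>n. n \<in> A \<longleftrightarrow> (\<forall>f. sat f ((\<lambda>_. 0)(0 := n)) p))"

definition many_one_reducible :: "nat set \<Rightarrow> nat set \<Rightarrow> bool" where
  "many_one_reducible B A \<longleftrightarrow> (\<exists>h. computable h \<and> (\<forall>n. n \<in> B \<longleftrightarrow> h n \<in> A))"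

definition Pi11_complete :: "nat set \<Rightarrow> bool" where
  "Pi11_complete A \<longleftrightarrow> Pi11 A \<and> (\<forall>B. Pi11 B \<longrightarrow> many_one_reducible B A)"

end

theory Submission
  imports Defs "HOL-Library.Extended_Nat"
begin

text \<open>
  The relation is the least one that contains Kleene equality and is closed under the rule
  ``if \<open>s x\<close> and \<open>t x\<close> are related for all \<open>x\<close>, then so are \<open>s\<close> and \<open>t\<close>'', because well-founded
  countably branching derivations have countable ranks.

  Membership in \<open>\<Pi>\<^sup>1\<^sub>1\<close>: quantify over all relations closed under the rules. The function variable
  also carries a table of the pairing function, of all runs of all programs, and of the values of
  all closed terms. As \<open>run\<close> is defined by structural recursion, such a table is determined by
  purely arithmetical conditions, and no arithmetisation of computations is needed.

  Hardness: the complement of a \<open>\<Pi>\<^sup>1\<^sub>1\<close> set is reduced to the existence of an infinite path in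
  a computable tree. For every node of the tree there are two elements of \<open>K1\<close> which, applied to
  \<open>x\<close>, return the corresponding elements for the child \<open>x\<close>, or the common value \<open>0\<close> if that child
  is not in the tree. The two elements of the root are related iff there is no infinite path.
\<close>

section \<open>The relation as an inductive closure\<close>

inductive eqv :: "('a \<Rightarrow> 'a \<Rightarrow> 'a option) \<Rightarrow> 'a cterm \<Rightarrow> 'a cterm \<Rightarrow> bool" for app where
  eqv_base: "kleene_eq app s t \<Longrightarrow> eqv app s t"
| eqv_step: "(\<And>x. eqv app (App s (Elem x)) (App t (Elem x))) \<Longrightarrow> eqv app s t"

lemma kleene_eq_App: "kleene_eq app s t \<Longrightarrow> kleene_eq app (App s u) (App t u)"
  by (simp add: kleene_eq_def)

lemma sim_imp_eqv: "sim app r \<alpha> s t \<Longrightarrow> eqv app s t"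
  by (induction rule: sim.induct) (auto intro: eqv.intros)

section \<open>Monotonicity of the ranked relations in the ordinal\<close>

lemma Well_order_induct [consumes 2, case_names less]:
  assumes "Well_order r" "\<alpha> \<in> Field r"
    and "\<And>\<alpha>. \<alpha> \<in> Field r \<Longrightarrow> (\<And>\<beta>. \<beta> \<in> underS r \<alpha> \<Longrightarrow> P \<beta>) \<Longrightarrow> P \<alpha>"
  shows "P \<alpha>"
proof -
  interpret wo_rel r using assms(1) by (simp add: wo_rel_def)
  have "\<alpha> \<in> Field r \<longrightarrow> P \<alpha>"
    by (rule well_order_induct)
      (use assms(3) in \<open>auto simp: underS_def intro: FieldI1\<close>)
  with assms(2) show ?thesis by blast
qed

lemma sim_kleene_eq:
  assumes "Well_order r" "\<alpha> \<in> Field r" "kleene_eq app s t"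
  shows "sim app r \<alpha> s t"
  using assms
proof (induction arbitrary: s t rule: Well_order_induct)
  case (less \<alpha>)
  from less.hyps show ?case
  proof (cases rule: wo_cases)
    case 1
    then show ?thesis using less.prems by (rule sim_zero)
  next
    case (2 \<beta>)
    then show ?thesis
      using less.IH[OF wo_succ_underS[OF assms(1) 2]] less.prems
      by (blast intro: sim_succ kleene_eq_App)
  next
    case 3
    then show ?thesis
      using less by (metis all_not_in_conv sim_limit wo_limit_def)
  qed
qed

text \<open>
  The hypothesis at all \<open>\<gamma>\<close> above \<open>\<beta>\<close> allows this lemma to be used in the inductive proof of
  monotonicity of \<open>sim\<close> in the ordinal.
\<close>

lemma sim_above:
  assumes wo: "Well_order r" and "\<beta> \<in> underS r \<alpha>"
    and up: "\<And>x \<gamma>. (\<beta>, \<gamma>) \<in> r \<Longrightarrow> sim app r \<gamma> (App s (Elem x)) (App t (Elem x))"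
  shows "sim app r \<alpha> s t"
proof -
  have "\<alpha> \<in> Field r" using assms(2) by (auto simp: underS_def Field_def)
  with wo show ?thesis using assms(2)
  proof (induction rule: Well_order_induct)
    case (less \<alpha>)
    from less.hyps show ?case
    proof (cases rule: wo_cases)
      case 1
      then show ?thesis using less.prems by (auto simp: wo_zero_def)
    next
      case (2 \<gamma>)
      then have "(\<beta>, \<gamma>) \<in> r" using less.prems by (auto simp: wo_succ_def under_def)
      then show ?thesis using 2 up by (blast intro: sim_succ)
    next
      case 3
      have ord: "trans r" "antisym r" "Refl r" "Total r" using wo by (auto simp: order_on_defs)
      have "\<beta> \<in> Field r" using less.prems by (auto simp: underS_def Field_def)
      \<comment> \<open>A limit is not the successor of \<open>\<beta>\<close>, so some
        \<open>\<delta>\<close> lies strictly between \<open>\<beta>\<close> and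
        \<open>\<alpha>\<close>; the induction hypothesis applies to it.\<close>
      then have "underS r \<alpha> \<noteq> under r \<beta>"
        using 3 by (auto simp: wo_limit_def wo_succ_def)
      moreover have "under r \<beta> \<subseteq> underS r \<alpha>"
        using less.prems ord(1,2)
        by (auto simp: under_def underS_def dest: transD antisymD)
      ultimately obtain \<delta> where \<delta>: "\<delta> \<in> underS r \<alpha>" "(\<delta>, \<beta>) \<notin> r"
        by (auto simp: under_def)
      then have "\<delta> \<in> Field r" by (auto simp: underS_def Field_def)
      then have "\<beta> \<in> underS r \<delta>"
        using \<delta>(2) \<open>\<beta> \<in> Field r\<close> ord(3,4)
        unfolding underS_def refl_on_def total_on_def by (smt (verit) mem_Collect_eq)
      then show ?thesis using less.IH \<delta>(1) 3 by (blast intro: sim_limit)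
    qed
  qed
qed

lemma underS_under_trans:
  assumes "Well_order r" "\<beta> \<in> underS r \<alpha>" "(\<alpha>, \<gamma>) \<in> r"
  shows "\<beta> \<in> underS r \<gamma>"
proof -
  have "trans r" "antisym r" using assms(1) by (auto simp: order_on_defs)
  with assms(2,3) show ?thesis by (auto simp: underS_def dest: transD antisymD)
qed

text \<open>Needed to give all premises of a rule one common rank. In the successor case the
  induction hypothesis holds at every ordinal above the rank of the premises, which is exactly what
  \<open>sim_above\<close> asks for.\<close>

lemma sim_mono:
  assumes "Well_order r" "sim app r \<alpha> s t" "(\<alpha>, \<beta>) \<in> r"
  shows "sim app r \<beta> s t"
  using assms(2,3)
proof (induction arbitrary: \<beta> rule: sim.induct)
  case (sim_zero \<alpha> s t)
  then show ?case using assms(1) by (auto intro!: sim_kleene_eq simp: Field_def)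
next
  case (sim_succ \<gamma> \<alpha> s t)
  have "\<gamma> \<in> underS r \<beta>"
    using underS_under_trans[OF assms(1) wo_succ_underS[OF assms(1) sim_succ.hyps(1)]] sim_succ.prems .
  then show ?case using sim_succ.IH by (rule sim_above[OF assms(1)])
next
  case (sim_limit \<alpha> \<gamma> s t)
  then show ?case
    using underS_under_trans[OF assms(1) sim_limit.hyps(2) sim_limit.prems]
    by (auto simp: underS_def)
qed

text \<open>The map may send successors to limits and skip ordinals; \<open>sim_above\<close> and
  \<open>sim_mono\<close> bridge the gaps, so strict monotonicity suffices.\<close>

lemma sim_strict_mono_map:
  assumes "Well_order r'"
    and f: "\<And>\<alpha> \<beta>. \<alpha> \<in> underS r \<beta> \<Longrightarrow> f \<alpha> \<in> underS r' (f \<beta>)" "f ` Field r \<subseteq> Field r'"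
    and "Well_order r" "sim app r \<alpha> s t"
  shows "sim app r' (f \<alpha>) s t"
  using assms(5)
proof (induction rule: sim.induct)
  case (sim_zero \<alpha> s t)
  then show ?case using assms(1) f(2) by (auto intro!: sim_kleene_eq simp: wo_zero_def)
next
  case (sim_succ \<beta> \<alpha> s t)
  show ?case
    using f(1)[OF wo_succ_underS[OF assms(4) sim_succ.hyps(1)]] sim_mono[OF assms(1) sim_succ.IH]
    by (rule sim_above[OF assms(1)])
next
  case (sim_limit \<alpha> \<gamma> s t)
  then show ?case
    using f(1)[OF sim_limit.hyps(2)] sim_mono[OF assms(1)] by (auto simp: underS_def)
qed

section \<open>Ordinal sums of well-orders along a well-ordered index type\<close>

definition lex_sum :: "('i::order \<Rightarrow> 'a rel) \<Rightarrow> ('i \<times> 'a) rel" where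
  "lex_sum r = {((i, a), (j, b)). a \<in> Field (r i) \<and> b \<in> Field (r j) \<and>
     (i < j \<or> i = j \<and> (a, b) \<in> r i)}"

lemma Field_lex_sum:
  assumes "\<And>i. Well_order (r i)"
  shows "Field (lex_sum r) = {(i, a). a \<in> Field (r i)}"
proof -
  have "(a, a) \<in> r i" if "a \<in> Field (r i)" for a i
    using assms[of i] that by (auto simp: order_on_defs dest: refl_onD)
  then have "((i, a), (i, a)) \<in> lex_sum r" if "a \<in> Field (r i)" for a i
    using that by (simp add: lex_sum_def)
  then show ?thesis by (auto simp: lex_sum_def Field_def[of "Collect _"] intro: FieldI1)
qed

lemma Well_order_lex_sum:
  fixes r :: "'i::wellorder \<Rightarrow> 'a rel"
  assumes wo: "\<And>i. Well_order (r i)"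
  shows "Well_order (lex_sum r)"
proof -
  have props: "Refl (r i)" "trans (r i)" "antisym (r i)" "Total (r i)" "wf (r i - Id)" for i
    using wo[of i] by (auto simp: order_on_defs)
  have "Refl (lex_sum r)"
    using props(1) by (auto simp: refl_on_def Field_lex_sum[OF wo]) (auto simp: lex_sum_def)
  moreover have "trans (lex_sum r)"
    by (rule transI) (auto simp: lex_sum_def dest: less_trans transD[OF props(2)])
  moreover have "antisym (lex_sum r)"
    using props(3) by (auto simp: lex_sum_def antisym_def)
  moreover have "Total (lex_sum r)"
    unfolding total_on_def Field_lex_sum[OF wo]
    by (auto simp: lex_sum_def) (meson props(4) total_on_def)
  moreover have "wf (lex_sum r - Id)"
  proof (rule wfUNIVI)
    fix P and z :: "'i \<times> 'a"
    assume IH: "\<forall>z. (\<forall>y. (y, z) \<in> lex_sum r - Id \<longrightarrow> P y) \<longrightarrow> P z"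
    \<comment> \<open>Outer induction on the summand, inner induction within it.\<close>
    have "P (i, a)" for i a
    proof (induction i arbitrary: a rule: less_induct)
      case (less i)
      show ?case
      proof (induction a rule: wf_induct_rule[OF props(5)[of i]])
        case (1 a)
        show ?case
          by (rule IH[rule_format]) (use less 1 in \<open>auto simp: lex_sum_def\<close>)
      qed
    qed
    then show "P z" by (cases z) auto
  qed
  moreover have "lex_sum r \<subseteq> Field (lex_sum r) \<times> Field (lex_sum r)"
    by (auto intro: FieldI1 FieldI2)
  ultimately show ?thesis
    by (simp add: order_on_defs)
qed

section \<open>From derivations to countable ordinals\<close>

lemma sim_transport:
  fixes r :: "'b rel" and f :: "'b \<Rightarrow> 'o"
  assumes "Well_order r" "inj f" "\<gamma> \<in> Field r" "sim app r \<gamma> s t"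
  shows "\<exists>(r' :: 'o rel) \<gamma>'. Well_order r' \<and> \<gamma>' \<in> Field r' \<and> sim app r' \<gamma>' s t"
proof (intro exI conjI)
  show wo: "Well_order (dir_image r f)"
    using assms by (auto intro!: Well_order_dir_image intro: inj_on_subset)
  show "f \<gamma> \<in> Field (dir_image r f)" using assms by (simp add: dir_image_Field)
  show "sim app (dir_image r f) (f \<gamma>) s t"
    by (rule sim_strict_mono_map[OF wo _ _ assms(1,4)])
      (use assms(2) in \<open>simp_all only: dir_image_Field subset_refl, auto simp: dir_image_def underS_def inj_eq\<close>)
qed

text \<open>A step has only countably many premises, so the ordinal sum of their ranks is still
  countable, and a slightly longer order ranks the conclusion.\<close>

lemma eqv_imp_sim_nat:
  fixes app :: "'a :: countable \<Rightarrow> 'a \<Rightarrow> 'a option"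
  assumes "eqv app s t"
  shows "\<exists>(r :: nat rel) \<gamma>. Well_order r \<and> \<gamma> \<in> Field r \<and> sim app r \<gamma> s t"
  using assms
proof (induction rule: eqv.induct)
  case (eqv_base s t)
  then show ?case
    using sim_kleene_eq[OF natLeq_Well_order, of 0] Field_natLeq natLeq_Well_order by blast
next
  case (eqv_step s t)
  then obtain r \<gamma> where r: "\<And>x. Well_order (r x)" "\<And>x. \<gamma> x \<in> Field (r x)"
      "\<And>x. sim app (r x :: nat rel) (\<gamma> x) (App s (Elem x)) (App t (Elem x))"
    by metis
  \<comment> \<open>The summand at \<open>\<infinity>\<close> provides two elements above all the ranks of the premises.\<close>
  define R where "R i = (case i of enat n \<Rightarrow> r (from_nat n) | \<infinity> \<Rightarrow> natLeq)" for i
  have woR: "Well_order (R i)" for i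
    using r(1) natLeq_Well_order by (auto simp: R_def split: enat.split)
  let ?L = "lex_sum R"
  have woL: "Well_order ?L" by (rule Well_order_lex_sum[OF woR])
  have FL: "Field ?L = {(i, a). a \<in> Field (R i)}" by (rule Field_lex_sum[OF woR])
  have nat_mem: "(n :: nat) \<in> Field (R \<infinity>)" for n by (simp add: R_def Field_natLeq)
  \<comment> \<open>The order of premise \<open>x\<close> embeds as the summand with index
    \<open>enat (to_nat x)\<close>.\<close>
  have below: "sim app ?L (enat (to_nat x), \<gamma> x) (App s (Elem x)) (App t (Elem x))" for x
    by (rule sim_strict_mono_map[OF woL _ _ r(1) r(3)])
      (use FL in \<open>auto simp: lex_sum_def R_def underS_def intro: FieldI1 FieldI2\<close>)
  have "sim app ?L (\<infinity>, 0) (App s (Elem x)) (App t (Elem x))" for x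
    by (rule sim_mono[OF woL below[of x]])
      (use r(2)[of x] nat_mem in \<open>auto simp: lex_sum_def R_def\<close>)
  \<comment> \<open>One element bounds all premises; the conclusion needs a second one strictly
    above it.\<close>
  moreover have top: "(\<infinity>, 0) \<in> underS ?L (\<infinity>, 1)"
    using nat_mem by (auto simp: underS_def lex_sum_def R_def natLeq_def)
  ultimately have "sim app ?L (\<infinity>, 1) s t"
    using sim_mono[OF woL] by (blast intro: sim_above[OF woL])
  moreover have "(\<infinity>, 1) \<in> Field ?L" using nat_mem by (simp add: FL)
  \<comment> \<open>The sum lives on the countable type of pairs from \<open>enat\<close> and
    \<open>nat\<close>, so it can be copied back to \<open>nat\<close>.\<close>
  ultimately show ?case
    using sim_transport[OF woL inj_to_nat] by blast
qed

text \<open>An infinite type contains a copy of \<open>nat\<close>, and the ordinals carried by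
  \<open>nat\<close> already exhaust the inductive closure.\<close>

lemma ext_equiv_iff_eqv:
  fixes app :: "'a :: countable \<Rightarrow> 'a \<Rightarrow> 'a option"
  assumes "infinite (UNIV :: 'o set)"
  shows "ext_equiv TYPE('o) app s t \<longleftrightarrow> eqv app s t"
proof
  show "ext_equiv TYPE('o) app s t \<Longrightarrow> eqv app s t"
    by (auto simp: ext_equiv_def intro: sim_imp_eqv)
next
  assume "eqv app s t"
  moreover obtain f :: "nat \<Rightarrow> 'o" where "inj f"
    using assms infinite_countable_subset by blast
  ultimately show "ext_equiv TYPE('o) app s t"
    using eqv_imp_sim_nat[of app s t] sim_transport[of _ f _ app s t]
    unfolding ext_equiv_def by blast
qed


section \<open>Definability\<close>

text \<open>
  An injective pairing that, unlike \<open>prod_encode\<close>, is a term of arithmetic. The definitions below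
  split one function into four tables: for \<open>prod_encode\<close>, for \<open>Phi\<close>, for \<open>val K1\<close>, and for a
  relation (true at the zeros) that is closed under the rules.
\<close>

definition idx :: "nat \<Rightarrow> nat \<Rightarrow> nat" where
  "idx a b = (a + b) * (a + b) + a"

text \<open>The value lies between the square of \<open>a + b\<close> and the next square, so it
  determines \<open>a + b\<close>, and then \<open>a\<close>.\<close>

lemma idx_inj: "idx a b = idx c d \<longleftrightarrow> a = c \<and> b = d"
proof
  assume eq: "idx a b = idx c d"
  have bounds: "m * m \<le> m * m + k \<and> m * m + k < Suc m * Suc m" if "k \<le> m" for m k :: nat
    using that by simp
  have mono: "Suc m * Suc m \<le> n * n" if "m < n" for m n :: nat
    using that by (intro mult_le_mono) auto
  have "a + b = c + d"
    using eq bounds[of a "a + b"] bounds[of c "c + d"] mono[of "a + b" "c + d"]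
      mono[of "c + d" "a + b"] unfolding idx_def
    by (cases "a + b" "c + d" rule: linorder_cases) linarith+
  with eq show "a = c \<and> b = d" by (simp add: idx_def)
qed simp

definition tab_pair :: "(nat \<Rightarrow> nat) \<Rightarrow> nat \<Rightarrow> nat \<Rightarrow> nat" where
  "tab_pair f a b = f (idx 0 (idx a b))"

definition tab_run :: "(nat \<Rightarrow> nat) \<Rightarrow> nat \<Rightarrow> nat \<Rightarrow> nat" where
  "tab_run f c x = f (idx 1 (idx c x))"

definition tab_val :: "(nat \<Rightarrow> nat) \<Rightarrow> nat \<Rightarrow> nat" where
  "tab_val f c = f (idx 2 c)"

definition tab_rel :: "(nat \<Rightarrow> nat) \<Rightarrow> nat \<Rightarrow> nat \<Rightarrow> nat" where
  "tab_rel f a b = f (idx 3 (idx a b))"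

text \<open>With 0 for undefined and values shifted by one, Kleene equality becomes equality of
  numbers.\<close>

primrec opt_code :: "nat option \<Rightarrow> nat" where
  "opt_code None = 0"
| "opt_code (Some v) = v + 1"

text \<open>The codes 0 and 1 mean "undefined" and "value 0". As the language has no order symbol,
  \<open>m < n\<close> is written \<open>n = m + k + 1\<close>.\<close>

definition tab_zero :: "(nat \<Rightarrow> nat) \<Rightarrow> nat \<Rightarrow> nat \<Rightarrow> nat \<Rightarrow> bool" where
  "tab_zero f c x n \<longleftrightarrow> tab_run f c (tab_pair f x n) = 1 \<and>
     (\<forall>m k. n = m + k + 1 \<longrightarrow> tab_run f c (tab_pair f x m) \<noteq> 0 \<and> tab_run f c (tab_pair f x m) \<noteq> 1)"

text \<open>One group of clauses per program constructor, with divergence stored explicitly as 0.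
  For minimisation only convergence is described; the entry 0 is what remains when no
  \<open>n\<close> qualifies.\<close>

definition tab_run_ok :: "(nat \<Rightarrow> nat) \<Rightarrow> bool" where
  "tab_run_ok f \<longleftrightarrow>
     (\<forall>x. tab_run f 0 x = 1) \<and>
     (\<forall>x. tab_run f 1 x = x + 2) \<and>
     (\<forall>a b. tab_run f 2 (tab_pair f a b) = a + 1) \<and>
     (\<forall>a b. tab_run f 3 (tab_pair f a b) = b + 1) \<and>
     (\<forall>c d x. tab_run f c x = 0 \<or> tab_run f d x = 0 \<longrightarrow>
        tab_run f (4 + 4 * tab_pair f c d) x = 0) \<and>
     (\<forall>c d x a b. tab_run f c x = a + 1 \<and> tab_run f d x = b + 1 \<longrightarrow>
        tab_run f (4 + 4 * tab_pair f c d) x = tab_pair f a b + 1) \<and>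
     (\<forall>c d x. tab_run f d x = 0 \<longrightarrow> tab_run f (5 + 4 * tab_pair f c d) x = 0) \<and>
     (\<forall>c d x b. tab_run f d x = b + 1 \<longrightarrow>
        tab_run f (5 + 4 * tab_pair f c d) x = tab_run f c b) \<and>
     (\<forall>c d a. tab_run f (6 + 4 * tab_pair f c d) (tab_pair f a 0) = tab_run f c a) \<and>
     (\<forall>c d a k. tab_run f (6 + 4 * tab_pair f c d) (tab_pair f a k) = 0 \<longrightarrow>
        tab_run f (6 + 4 * tab_pair f c d) (tab_pair f a (k + 1)) = 0) \<and>
     (\<forall>c d a k b. tab_run f (6 + 4 * tab_pair f c d) (tab_pair f a k) = b + 1 \<longrightarrow>
        tab_run f (6 + 4 * tab_pair f c d) (tab_pair f a (k + 1)) =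
        tab_run f d (tab_pair f a (tab_pair f k b))) \<and>
     (\<forall>c x n. tab_run f (7 + 4 * c) x = n + 1 \<longleftrightarrow> tab_zero f c x n)"

definition tab_val_ok :: "(nat \<Rightarrow> nat) \<Rightarrow> bool" where
  "tab_val_ok f \<longleftrightarrow>
     (\<forall>n. tab_val f (2 * n) = n + 1) \<and>
     (\<forall>a b. tab_val f a = 0 \<or> tab_val f b = 0 \<longrightarrow> tab_val f (2 * tab_pair f a b + 1) = 0) \<and>
     (\<forall>a b u v. tab_val f a = u + 1 \<and> tab_val f b = v + 1 \<longrightarrow>
        tab_val f (2 * tab_pair f a b + 1) = tab_run f u v)"

text \<open>Only closure under the two rules is demanded; leastness comes from the universal
  quantifier over \<open>f\<close>. The numbers \<open>2 * x\<close> and \<open>2 * p + 1\<close>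
  code elements and applications.\<close>

definition tab_rel_ok :: "(nat \<Rightarrow> nat) \<Rightarrow> bool" where
  "tab_rel_ok f \<longleftrightarrow>
     (\<forall>a b. tab_val f a = tab_val f b \<longrightarrow> tab_rel f a b = 0) \<and>
     (\<forall>a b. (\<forall>x. tab_rel f (2 * tab_pair f a (2 * x) + 1) (2 * tab_pair f b (2 * x) + 1) = 0) \<longrightarrow>
        tab_rel f a b = 0)"

text \<open>The first equation pins down the Cantor pairing; doubling it avoids division.\<close>

definition is_table :: "(nat \<Rightarrow> nat) \<Rightarrow> bool" where
  "is_table f \<longleftrightarrow> (\<forall>a b. 2 * tab_pair f a b = (a + b) * (a + b + 1) + 2 * a) \<and>
     tab_run_ok f \<and> tab_val_ok f \<and> tab_rel_ok f"

section \<open>The arithmetical formula describing tables\<close>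

definition Imp :: "aform \<Rightarrow> aform \<Rightarrow> aform" where "Imp p q = Neg (Conj p (Neg q))"
definition Disj :: "aform \<Rightarrow> aform \<Rightarrow> aform" where "Disj p q = Neg (Conj (Neg p) (Neg q))"

lemma sat_Imp_Disj [simp]:
  "sat f e (Imp p q) \<longleftrightarrow> (sat f e p \<longrightarrow> sat f e q)"
  "sat f e (Disj p q) \<longleftrightarrow> sat f e p \<or> sat f e q"
  by (auto simp: Imp_def Disj_def)

primrec num_term :: "nat \<Rightarrow> aterm" where
  "num_term 0 = Null"
| "num_term (Suc n) = TSuc (num_term n)"

definition idx_term :: "aterm \<Rightarrow> aterm \<Rightarrow> aterm" where
  "idx_term t u = Add (Mult (Add t u) (Add t u)) t"

definition pair_term :: "aterm \<Rightarrow> aterm \<Rightarrow> aterm" where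
  "pair_term t u = Fun (idx_term Null (idx_term t u))"

definition run_term :: "aterm \<Rightarrow> aterm \<Rightarrow> aterm" where
  "run_term t u = Fun (idx_term (num_term 1) (idx_term t u))"

definition val_term :: "aterm \<Rightarrow> aterm" where
  "val_term t = Fun (idx_term (num_term 2) t)"

definition rel_term :: "aterm \<Rightarrow> aterm \<Rightarrow> aterm" where
  "rel_term t u = Fun (idx_term (num_term 3) (idx_term t u))"

definition lin_term :: "nat \<Rightarrow> nat \<Rightarrow> aterm \<Rightarrow> aterm" where
  "lin_term m n t = Add (num_term m) (Mult (num_term n) t)"

lemma tval_num_term [simp]: "tval f e (num_term n) = n"
  by (induction n) auto

lemma tval_table_terms [simp]:
  "tval f e (pair_term t u) = tab_pair f (tval f e t) (tval f e u)"
  "tval f e (run_term t u) = tab_run f (tval f e t) (tval f e u)"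
  "tval f e (val_term t) = tab_val f (tval f e t)"
  "tval f e (rel_term t u) = tab_rel f (tval f e t) (tval f e u)"
  "tval f e (lin_term m n t) = m + n * tval f e t"
  by (simp_all add: idx_term_def idx_def pair_term_def run_term_def val_term_def rel_term_def
      lin_term_def tab_pair_def tab_run_def tab_val_def tab_rel_def)

text \<open>Variables 1, 2, 3 hold the program code, the input and the candidate, in agreement with
  the minimisation clause of \<open>table_form\<close>.\<close>

definition zero_form :: aform where
  "zero_form = Conj (Eq (run_term (Var 1) (pair_term (Var 2) (Var 3))) (num_term 1))
     (Forall 4 (Forall 5 (Imp (Eq (Var 3) (TSuc (Add (Var 4) (Var 5))))
       (Conj (Neg (Eq (run_term (Var 1) (pair_term (Var 2) (Var 4))) Null))
         (Neg (Eq (run_term (Var 1) (pair_term (Var 2) (Var 4))) (num_term 1)))))))"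

text \<open>\<open>All\<close> closes every clause over the same five variables, whichever occur;
  \<open>Eq Null Null\<close> is the neutral end of the conjunction.\<close>

definition table_form :: aform where
  "table_form = (let a = Var 1; b = Var 2; x = Var 3; u = Var 4; v = Var 5;
      All = (\<lambda>p. Forall 1 (Forall 2 (Forall 3 (Forall 4 (Forall 5 p)))));
      op = (\<lambda>m. lin_term m 4 (pair_term a b)); ap = (\<lambda>t u. lin_term 1 2 (pair_term t u)) in
    foldr Conj
     [All (Eq (lin_term 0 2 (pair_term a b))
        (Add (Mult (Add a b) (TSuc (Add a b))) (lin_term 0 2 a))),
      All (Eq (run_term Null a) (num_term 1)),
      All (Eq (run_term (num_term 1) a) (TSuc (TSuc a))),
      All (Eq (run_term (num_term 2) (pair_term a b)) (TSuc a)),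
      All (Eq (run_term (num_term 3) (pair_term a b)) (TSuc b)),
      All (Imp (Disj (Eq (run_term a x) Null) (Eq (run_term b x) Null))
        (Eq (run_term (op 4) x) Null)),
      All (Imp (Conj (Eq (run_term a x) (TSuc u)) (Eq (run_term b x) (TSuc v)))
        (Eq (run_term (op 4) x) (TSuc (pair_term u v)))),
      All (Imp (Eq (run_term b x) Null) (Eq (run_term (op 5) x) Null)),
      All (Imp (Eq (run_term b x) (TSuc u)) (Eq (run_term (op 5) x) (run_term a u))),
      All (Eq (run_term (op 6) (pair_term x Null)) (run_term a x)),
      All (Imp (Eq (run_term (op 6) (pair_term x u)) Null)
        (Eq (run_term (op 6) (pair_term x (TSuc u))) Null)),
      All (Imp (Eq (run_term (op 6) (pair_term x u)) (TSuc v))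
        (Eq (run_term (op 6) (pair_term x (TSuc u)))
          (run_term b (pair_term x (pair_term u v))))),
      All (Conj (Imp (Eq (run_term (lin_term 7 4 a) b) (TSuc x)) zero_form)
        (Imp zero_form (Eq (run_term (lin_term 7 4 a) b) (TSuc x)))),
      All (Eq (val_term (lin_term 0 2 a)) (TSuc a)),
      All (Imp (Disj (Eq (val_term a) Null) (Eq (val_term b) Null)) (Eq (val_term (ap a b)) Null)),
      All (Imp (Conj (Eq (val_term a) (TSuc u)) (Eq (val_term b) (TSuc v)))
        (Eq (val_term (ap a b)) (run_term u v))),
      All (Imp (Eq (val_term a) (val_term b)) (Eq (rel_term a b) Null)),
      All (Imp (Forall 3 (Eq (rel_term (ap a (lin_term 0 2 x)) (ap b (lin_term 0 2 x))) Null))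
        (Eq (rel_term a b) Null))]
     (Eq Null Null))"

lemma sat_zero_form [simp]: "sat f e zero_form \<longleftrightarrow> tab_zero f (e 1) (e 2) (e 3)"
  by (simp add: zero_form_def tab_zero_def)

lemma sat_table_form: "sat f e table_form \<longleftrightarrow> is_table f"
proof -
  have "sat f e table_form \<longleftrightarrow> (\<forall>a b. 2 * tab_pair f a b = (a + b) * (a + b + 1) + 2 * a) \<and>
    tab_run_ok f \<and> tab_val_ok f \<and> tab_rel_ok f"
    \<comment> \<open>The formula spells the equivalence for minimisation as two
      implications.\<close>
    unfolding tab_run_ok_def tab_val_ok_def tab_rel_ok_def iff_conv_conj_imp[of "tab_run f _ _ = _"]
    by (simp add: table_form_def Let_def)
  then show ?thesis by (simp add: is_table_def)
qed

section \<open>Codes of pairs, programs and closed terms\<close>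

lemma two_prod_encode: "2 * prod_encode (a, b) = (a + b) * (a + b + 1) + 2 * a"
proof -
  have "2 * triangle n = n * (n + 1)" for n
    by (simp add: triangle_def)
  then show ?thesis by (simp add: prod_encode_def)
qed

lemma Phi_prog_encode: "Phi (prog_encode c) = run c"
  by (simp add: Phi_def inv_f_f bij_is_inj[OF bij_prog_encode])

lemma inj_cterm_encode: "cterm_encode s = cterm_encode t \<Longrightarrow> s = t"
proof (induction s arbitrary: t)
  case (Elem n)
  then show ?case by (cases t) (auto, presburger)
next
  case (App s1 s2)
  then show ?case by (cases t) (auto, presburger)
qed

lemma surj_cterm_encode: "\<exists>t. cterm_encode t = n"
proof (induction n rule: less_induct)
  case (less n)
  show ?case
  proof (cases "even n")
    case True
    then show ?thesis by (metis cterm_encode.simps(1) evenE)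
  next
    case False
    then obtain q where q: "n = 2 * q + 1" by (metis oddE)
    obtain a b where ab: "q = prod_encode (a, b)"
      by (metis prod.collapse prod_decode_inverse)
    have "a < n" "b < n"
      using le_prod_encode_1[of a b] le_prod_encode_2[of b a] q ab by auto
    then obtain s t where "cterm_encode s = a" "cterm_encode t = b"
      using less.IH by metis
    then have "cterm_encode (App s t) = n" using q ab by simp
    then show ?thesis ..
  qed
qed

lemma bij_cterm_encode: "bij cterm_encode"
  by (metis bij_def injI inj_cterm_encode surj_cterm_encode surjI surj_def)

text \<open>Replaces the least-number operator by the condition that \<open>tab_zero\<close>
  expresses.\<close>

lemma minimise_eq_Some_iff:
  "minimise g = Some n \<longleftrightarrow> g n = Some 0 \<and> (\<forall>m<n. g m \<noteq> None \<and> g m \<noteq> Some 0)"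
proof
  assume min: "minimise g = Some n"
  then obtain k where k: "g k = Some 0" "\<forall>m<k. g m \<noteq> None"
    by (auto simp: minimise_def split: if_splits)
  have n: "n = (LEAST n. g n = Some 0)"
    using min by (auto simp: minimise_def split: if_splits)
  then have "g n = Some 0" "n \<le> k"
    using k(1) by (auto intro: LeastI Least_le)
  moreover have "g m \<noteq> Some 0" if "m < n" for m
    using not_less_Least that n by blast
  ultimately show "g n = Some 0 \<and> (\<forall>m<n. g m \<noteq> None \<and> g m \<noteq> Some 0)"
    using k(2) by auto
next
  assume n: "g n = Some 0 \<and> (\<forall>m<n. g m \<noteq> None \<and> g m \<noteq> Some 0)"
  then have "(LEAST n. g n = Some 0) = n"
    by (intro Least_equality) (auto simp: not_le[symmetric] intro: leI)
  with n show "minimise g = Some n" by (auto simp: minimise_def)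
qed

lemma opt_code_simps [simp]: 
  "opt_code v = 0 \<longleftrightarrow> v = None"
  "opt_code v = Suc n \<longleftrightarrow> v = Some n"
  by (cases v; auto)+

lemma opt_code_inj [simp]: "opt_code v = opt_code w \<longleftrightarrow> v = w"
  by (cases v; cases w) auto

lemma run_PRec:
  "run (PRec c d) (prod_encode (a, 0)) = run c a"
  "run (PRec c d) (prod_encode (a, Suc k)) =
     Option.bind (run (PRec c d) (prod_encode (a, k)))
       (\<lambda>b. run d (prod_encode (a, prod_encode (k, b))))"
  by simp_all

section \<open>Tables are correct\<close>

context
  fixes f assumes f: "is_table f"
begin

lemma is_table_pair: "tab_pair f a b = prod_encode (a, b)"
proof -
  have "2 * tab_pair f a b = 2 * prod_encode (a, b)"
    using f by (simp only: is_table_def two_prod_encode)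
  then show ?thesis by simp
qed

lemma is_table_ok: "tab_run_ok f" "tab_val_ok f" "tab_rel_ok f"
  using f by (simp_all add: is_table_def)

text \<open>Each clause determines the entries of a compound program from those of its parts, so
  induction on programs suffices; inner induction is needed only on the recursion argument of
  \<open>PRec\<close>.\<close>

lemma is_table_run: "tab_run f (prog_encode c) x = opt_code (run c x)"
proof (induction c arbitrary: x)
  case Zero
  then show ?case using is_table_ok by (simp add: tab_run_ok_def tab_val_ok_def tab_rel_ok_def)
next
  case Succ
  then show ?case using is_table_ok by (simp add: tab_run_ok_def tab_val_ok_def tab_rel_ok_def)
next
  case Fst
  have "tab_run f 2 (tab_pair f (fst (prod_decode x)) (snd (prod_decode x)))
      = fst (prod_decode x) + 1"
    using is_table_ok(1) by (simp only: tab_run_ok_def)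
  then show ?case by (simp add: is_table_pair)
next
  case Snd
  have "tab_run f 3 (tab_pair f (fst (prod_decode x)) (snd (prod_decode x)))
      = snd (prod_decode x) + 1"
    using is_table_ok(1) by (simp only: tab_run_ok_def)
  then show ?case by (simp add: is_table_pair)
next
  case (Pair c d)
  have none: "run c x = None \<or> run d x = None \<Longrightarrow>
      tab_run f (4 + 4 * prod_encode (prog_encode c, prog_encode d)) x = 0"
    and some: "run c x = Some a \<Longrightarrow> run d x = Some b \<Longrightarrow>
      tab_run f (4 + 4 * prod_encode (prog_encode c, prog_encode d)) x = prod_encode (a, b) + 1" for a b
    using is_table_ok(1) Pair by (auto simp: tab_run_ok_def is_table_pair)
  then show ?case
    by (auto split: option.split simp del: add_2_eq_Suc add_2_eq_Suc')
next
  case (Comp c d)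
  have none: "run d x = None \<Longrightarrow>
      tab_run f (5 + 4 * prod_encode (prog_encode c, prog_encode d)) x = 0"
    and some: "run d x = Some b \<Longrightarrow>
      tab_run f (5 + 4 * prod_encode (prog_encode c, prog_encode d)) x = tab_run f (prog_encode c) b" for b
    using is_table_ok(1) Comp.IH(2) by (simp_all add: tab_run_ok_def is_table_pair)
  then show ?case
    by (cases "run d x") (auto simp: Comp.IH(1))
next
  case (PRec c d)
  let ?e = "6 + 4 * prod_encode (prog_encode c, prog_encode d)"
  have base: "tab_run f ?e (prod_encode (a, 0)) = opt_code (run c a)"
    and none: "tab_run f ?e (prod_encode (a, k)) = 0 \<Longrightarrow>
      tab_run f ?e (prod_encode (a, Suc k)) = 0"
    and some: "tab_run f ?e (prod_encode (a, k)) = Suc b \<Longrightarrow>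
      tab_run f ?e (prod_encode (a, Suc k)) =
        opt_code (run d (prod_encode (a, prod_encode (k, b))))" for a k b
    using is_table_ok(1) PRec by (simp_all add: tab_run_ok_def is_table_pair)
  obtain a n where x: "x = prod_encode (a, n)"
    by (metis prod.collapse prod_decode_inverse)
  have "tab_run f ?e (prod_encode (a, n)) = opt_code (run (PRec c d) (prod_encode (a, n)))"
  proof (induction n)
    case 0
    show ?case by (simp only: run_PRec base)
  next
    case (Suc n)
    show ?case
    proof (cases "run (PRec c d) (prod_encode (a, n))")
      case None
      with Suc show ?thesis by (simp only: run_PRec) (simp add: none)
    next
      case (Some b)
      with Suc show ?thesis by (simp only: run_PRec) (simp add: some)
    qed
  qed
  then show ?case by (simp only: x prog_encode.simps)
next
  case (Mu c)
  have "tab_zero f (prog_encode c) x n \<longleftrightarrow> run (Mu c) x = Some n" for n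
    by (auto simp: tab_zero_def minimise_eq_Some_iff is_table_pair Mu less_iff_Suc_add
        simp del: opt_code.simps)
  moreover have "tab_run f (7 + 4 * prog_encode c) x = n + 1 \<longleftrightarrow> tab_zero f (prog_encode c) x n" for n
    using is_table_ok(1) unfolding tab_run_ok_def by blast
  ultimately have "tab_run f (7 + 4 * prog_encode c) x = Suc n \<longleftrightarrow> run (Mu c) x = Some n" for n
    by simp
  \<comment> \<open>Two numbers that equal the same successors are equal, so divergence agrees as
    well.\<close>
  then show ?case
    by (metis not0_implies_Suc opt_code_simps option.exhaust prog_encode.simps(8))
qed

lemma is_table_Phi: "tab_run f u v = opt_code (Phi u v)"
  using is_table_run by (metis Phi_prog_encode prog_encode_surj)

lemma is_table_val: "tab_val f (cterm_encode t) = opt_code (val K1 t)"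
proof (induction t)
  case (Elem n)
  then show ?case using is_table_ok by (simp add: tab_run_ok_def tab_val_ok_def tab_rel_ok_def)
next
  case (App s t)
  have none: "val K1 s = None \<or> val K1 t = None \<Longrightarrow>
      tab_val f (2 * prod_encode (cterm_encode s, cterm_encode t) + 1) = 0"
    and some: "val K1 s = Some a \<Longrightarrow> val K1 t = Some b \<Longrightarrow>
      tab_val f (2 * prod_encode (cterm_encode s, cterm_encode t) + 1) = opt_code (Phi a b)" for a b
    using is_table_ok(2) App by (auto simp: tab_val_ok_def is_table_pair is_table_Phi)
  then show ?case by (auto split: option.split)
qed

lemma is_table_eqv: "eqv K1 s t \<Longrightarrow> tab_rel f (cterm_encode s) (cterm_encode t) = 0"
proof (induction rule: eqv.induct)
  case (eqv_base s t)
  then have "tab_val f (cterm_encode s) = tab_val f (cterm_encode t)"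
    by (simp add: is_table_val kleene_eq_def)
  then show ?case using is_table_ok by (simp add: tab_run_ok_def tab_val_ok_def tab_rel_ok_def)
next
  case (eqv_step s t)
  then show ?case using is_table_ok(3) by (simp add: tab_rel_ok_def is_table_pair)
qed

end

text \<open>Its relation is \<open>eqv\<close> itself, so this single function refutes the formula
  at every pair that is not related. The tag \<open>k\<close> selects the table; the value table
  reads \<open>y\<close> directly, the others split it.\<close>

definition std_table :: "nat \<Rightarrow> nat" where
  "std_table z = (let (k, y) = inv (case_prod idx) z; (a, b) = inv (case_prod idx) y in
     if k = 0 then prod_encode (a, b)
     else if k = 1 then opt_code (Phi a b)
     else if k = 2 then opt_code (val K1 (inv cterm_encode y))
     else if eqv K1 (inv cterm_encode a) (inv cterm_encode b) then 0 else 1)"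

lemma inv_idx [simp]: "inv (case_prod idx) (idx a b) = (a, b)"
proof -
  have "inj (case_prod idx)" by (auto simp: inj_def idx_inj)
  from inv_f_f[OF this, of "(a, b)"] show ?thesis by simp
qed

lemma inv_cterm_encode:
  "inv cterm_encode (2 * n) = Elem n"
  "inv cterm_encode (Suc (2 * prod_encode (a, b))) = App (inv cterm_encode a) (inv cterm_encode b)"
proof -
  have "cterm_encode (inv cterm_encode c) = c" for c
    using bij_cterm_encode by (simp add: bij_is_surj surj_f_inv_f)
  then show "inv cterm_encode (2 * n) = Elem n"
    "inv cterm_encode (Suc (2 * prod_encode (a, b))) = App (inv cterm_encode a) (inv cterm_encode b)"
    by (auto intro!: inv_f_eq bij_is_inj[OF bij_cterm_encode])
qed

lemma std_table_simps:
  "tab_pair std_table a b = prod_encode (a, b)"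
  "tab_run std_table a b = opt_code (Phi a b)"
  "tab_val std_table a = opt_code (val K1 (inv cterm_encode a))"
  "tab_rel std_table a b = (if eqv K1 (inv cterm_encode a) (inv cterm_encode b) then 0 else 1)"
  by (simp_all add: tab_pair_def tab_run_def tab_val_def tab_rel_def std_table_def
      split: prod.split)

lemma Phi_simps:
  "Phi 0 x = Some 0" "Phi 1 x = Some (Suc x)"
  "Phi 2 x = Some (fst (prod_decode x))" "Phi 3 x = Some (snd (prod_decode x))"
  "Phi (4 + 4 * prod_encode (c, d)) x =
     (case (Phi c x, Phi d x) of (Some a, Some b) \<Rightarrow> Some (prod_encode (a, b)) | _ \<Rightarrow> None)"
  "Phi (5 + 4 * prod_encode (c, d)) x = Option.bind (Phi d x) (Phi c)"
  "Phi (6 + 4 * prod_encode (c, d)) (prod_encode (a, 0)) = Phi c a"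
  "Phi (6 + 4 * prod_encode (c, d)) (prod_encode (a, Suc k)) =
     Option.bind (Phi (6 + 4 * prod_encode (c, d)) (prod_encode (a, k)))
       (\<lambda>b. Phi d (prod_encode (a, prod_encode (k, b))))"
  "Phi (7 + 4 * c) x = minimise (\<lambda>n. Phi c (prod_encode (x, n)))"
proof -
  obtain p where p: "prog_encode p = c" using prog_encode_surj by blast
  obtain q where q: "prog_encode q = d" using prog_encode_surj by blast
  note [simp] = Phi_prog_encode p[symmetric] q[symmetric]
  show "Phi 0 x = Some 0" using Phi_prog_encode[of Zero] by simp
  show "Phi 1 x = Some (Suc x)" using Phi_prog_encode[of Succ] by simp
  show "Phi 2 x = Some (fst (prod_decode x))" using Phi_prog_encode[of Fst] by simp
  show "Phi 3 x = Some (snd (prod_decode x))" using Phi_prog_encode[of Snd] by simp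
  show "Phi (4 + 4 * prod_encode (c, d)) x =
     (case (Phi c x, Phi d x) of (Some a, Some b) \<Rightarrow> Some (prod_encode (a, b)) | _ \<Rightarrow> None)"
    using Phi_prog_encode[of "Pair p q"] by simp
  show "Phi (5 + 4 * prod_encode (c, d)) x = Option.bind (Phi d x) (Phi c)"
    using Phi_prog_encode[of "Comp p q"] by simp
  have 6: "Phi (6 + 4 * prod_encode (c, d)) = run (PRec p q)"
    using Phi_prog_encode[of "PRec p q"] by simp
  show "Phi (6 + 4 * prod_encode (c, d)) (prod_encode (a, 0)) = Phi c a"
    "Phi (6 + 4 * prod_encode (c, d)) (prod_encode (a, Suc k)) =
     Option.bind (Phi (6 + 4 * prod_encode (c, d)) (prod_encode (a, k)))
       (\<lambda>b. Phi d (prod_encode (a, prod_encode (k, b))))"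
    unfolding 6 run_PRec by simp_all
  show "Phi (7 + 4 * c) x = minimise (\<lambda>n. Phi c (prod_encode (x, n)))"
    using Phi_prog_encode[of "Mu p"] by simp
qed

lemma is_table_std: "is_table std_table"
proof -
  have zero: "tab_zero std_table c x n \<longleftrightarrow> Phi (7 + 4 * c) x = Some n" for c x n
    by (auto simp: tab_zero_def minimise_eq_Some_iff std_table_simps Phi_simps less_iff_Suc_add
        simp del: opt_code.simps)
  have "tab_run_ok std_table"
    unfolding tab_run_ok_def zero
    by (simp add: std_table_simps Phi_simps Phi_simps(2)[simplified] split: option.split)
  moreover have "tab_val_ok std_table"
    by (auto simp: tab_val_ok_def std_table_simps inv_cterm_encode split: option.split)
  moreover have "tab_rel_ok std_table"
    by (auto simp: tab_rel_ok_def std_table_simps inv_cterm_encode kleene_eq_def intro: eqv.intros)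
  ultimately show ?thesis
    unfolding is_table_def std_table_simps(1) two_prod_encode by simp
qed

text \<open>Related pairs are zeros of the relation in every table by closure; unrelated ones fail
  in the standard table.\<close>

lemma Pi11_eqv: "Pi11 {prod_encode (cterm_encode s, cterm_encode t) | s t. eqv K1 s t}"
  (is "Pi11 ?A")
proof -
  define p where "p = Imp table_form (Forall 1 (Forall 2
    (Imp (Eq (Var 0) (pair_term (Var 1) (Var 2))) (Eq (rel_term (Var 1) (Var 2)) Null))))"
  have sat_p: "sat f ((\<lambda>_. 0)(0 := n)) p \<longleftrightarrow>
      (is_table f \<longrightarrow> (\<forall>a b. n = tab_pair f a b \<longrightarrow> tab_rel f a b = 0))" for f n
    by (simp add: p_def sat_table_form)
  have "n \<in> ?A \<longleftrightarrow> (\<forall>f. sat f ((\<lambda>_. 0)(0 := n)) p)" for n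
  proof
    show "n \<in> ?A \<Longrightarrow> \<forall>f. sat f ((\<lambda>_. 0)(0 := n)) p"
      unfolding sat_p by (auto simp: is_table_pair is_table_eqv)
  next
    assume "\<forall>f. sat f ((\<lambda>_. 0)(0 := n)) p"
    then have *: "\<forall>a b. n = prod_encode (a, b) \<longrightarrow> tab_rel std_table a b = 0"
      using is_table_std by (metis sat_p std_table_simps(1))
    obtain a b where n: "n = prod_encode (a, b)"
      by (metis prod.collapse prod_decode_inverse)
    obtain s t where st: "cterm_encode s = a" "cterm_encode t = b"
      using surj_cterm_encode by metis
    have "eqv K1 s t"
      using * n st by (auto simp: std_table_simps inv_f_f bij_is_inj[OF bij_cterm_encode]
          split: if_splits)
    then show "n \<in> ?A" using n st by blast
  qed
  then show ?thesis by (auto simp: Pi11_def)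
qed


section \<open>Closure properties of total computable functions\<close>

section \<open>Computable functions and effective functionals\<close>

abbreviation pair :: "nat \<Rightarrow> nat \<Rightarrow> nat" where "pair a b \<equiv> prod_encode (a, b)"
abbreviation pfst :: "nat \<Rightarrow> nat" where "pfst x \<equiv> fst (prod_decode x)"
abbreviation psnd :: "nat \<Rightarrow> nat" where "psnd x \<equiv> snd (prod_decode x)"

lemma computable_iff_run: "computable h \<longleftrightarrow> (\<exists>c. \<forall>x. run c x = Some (h x))"
  unfolding computable_def by (metis Phi_prog_encode prog_encode_surj)

lemma computable_comp: "computable f \<Longrightarrow> computable g \<Longrightarrow> computable (\<lambda>x. f (g x))"
  unfolding computable_iff_run by (metis bind.bind_lunit run.simps(6))

lemma computable_pair:
  "computable f \<Longrightarrow> computable g \<Longrightarrow> computable (\<lambda>x. pair (f x) (g x))"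
  unfolding computable_iff_run
  by (elim exE, rule_tac x = "Pair c ca" in exI) simp

lemma computable_pfst: "computable f \<Longrightarrow> computable (\<lambda>x. pfst (f x))"
  and computable_psnd: "computable f \<Longrightarrow> computable (\<lambda>x. psnd (f x))"
  and computable_Suc: "computable f \<Longrightarrow> computable (\<lambda>x. Suc (f x))"
  by (rule computable_comp[where g = f]; use run.simps in \<open>unfold computable_iff_run, blast\<close>)+

lemma computable_id: "computable (\<lambda>x. x)"
  unfolding computable_iff_run by (rule exI[of _ "Pair Fst Snd"]) simp

lemma computable_const: "computable (\<lambda>_. n)"
proof (induction n)
  case 0
  show ?case unfolding computable_iff_run by (rule exI[of _ Zero]) simp
next
  case (Suc n)
  then show ?case by (rule computable_Suc)
qed

lemma computable_rec:
  assumes "computable c" "computable d" "computable n"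
  shows "computable (\<lambda>x. rec_nat (c x) (\<lambda>k b. d (pair x (pair k b))) (n x))"
proof -
  obtain C D where CD: "\<And>x. run C x = Some (c x)" "\<And>x. run D x = Some (d x)"
    using assms(1,2) unfolding computable_iff_run by blast
  have "run (PRec C D) (pair x m) = Some (rec_nat (c x) (\<lambda>k b. d (pair x (pair k b))) m)" for x m
    by (induction m) (simp_all add: CD)
  then have "computable (\<lambda>y. rec_nat (c (pfst y)) (\<lambda>k b. d (pair (pfst y) (pair k b))) (psnd y))"
    unfolding computable_iff_run by (metis prod.collapse prod_decode_inverse)
  from computable_comp[OF this computable_pair[OF computable_id assms(3)]]
  show ?thesis by simp
qed

lemmas computable_basic = computable_pair computable_pfst computable_psnd computable_Suc
  computable_id computable_const

lemma computable_add:
  assumes "computable f" "computable g"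
  shows "computable (\<lambda>x. f x + g x)"
proof -
  have "rec_nat m (\<lambda>k b. Suc b) n = m + n" for m n :: nat
    by (induction n) auto
  then show ?thesis
    using computable_rec[OF assms(1) _ assms(2), of "\<lambda>y. Suc (psnd (psnd y))"]
    by (simp add: computable_basic)
qed

lemma computable_mult:
  assumes "computable f" "computable g"
  shows "computable (\<lambda>x. f x * g x)"
proof -
  have "rec_nat 0 (\<lambda>k b. b + m) n = m * n" for m n :: nat
    by (induction n) auto
  then show ?thesis
    using computable_rec[OF computable_const _ assms(2), of "\<lambda>y. psnd (psnd y) + f (pfst y)" 0]
    by (simp add: computable_basic computable_add computable_comp[OF assms(1)])
qed

lemma computable_diff:
  assumes "computable f" "computable g"
  shows "computable (\<lambda>x. f x - g x)"
proof -
  \<comment> \<open>The predecessor is the recursion that returns its counter; subtraction iterates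
    it.\<close>
  have "rec_nat 0 (\<lambda>k b. k) n = n - 1" for n :: nat
    by (cases n) auto
  then have pred: "computable h \<Longrightarrow> computable (\<lambda>x. h x - 1)" for h
    using computable_rec[OF computable_const _ , of "\<lambda>y. pfst (psnd y)" h 0]
    by (simp add: computable_basic)
  have "rec_nat m (\<lambda>k b. b - 1) n = m - n" for m n :: nat
    by (induction n) auto
  then show ?thesis
    using computable_rec[OF assms(1) _ assms(2), of "\<lambda>y. psnd (psnd y) - 1"]
    by (simp only: prod_encode_inverse snd_conv) (simp add: computable_basic pred[simplified])
qed

lemma computable_if_zero:
  assumes "computable c" "computable f" "computable g"
  shows "computable (\<lambda>x. if c x = 0 then f x else g x)"
proof -
  have "rec_nat a (\<lambda>k b. d) n = (if n = 0 then a else d)" for a d n :: nat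
    by (cases n) auto
  then show ?thesis
    using computable_rec[OF assms(2) _ assms(1), of "\<lambda>y. g (pfst y)"]
    by (simp add: computable_basic computable_comp[OF assms(3)])
qed

lemma computable_funpow:
  assumes "computable f" "computable n" "computable a"
  shows "computable (\<lambda>x. (f ^^ n x) (a x))"
proof -
  have "rec_nat a (\<lambda>k b. f b) n = (f ^^ n) a" for a n
    by (induction n) auto
  then show ?thesis
    using computable_rec[OF assms(3) _ assms(2), of "\<lambda>y. f (psnd (psnd y))"]
    by (simp add: computable_basic computable_comp[OF assms(1)])
qed

section \<open>Computable families of oracles and continuous functionals\<close>

definition computable2 :: "(nat \<Rightarrow> nat \<Rightarrow> nat) \<Rightarrow> bool" where
  "computable2 A \<longleftrightarrow> computable (\<lambda>y. A (pfst y) (psnd y))"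

lemma computable2_comp:
  assumes "computable2 A" "computable f" "computable g"
  shows "computable (\<lambda>x. A (f x) (g x))"
  using computable_comp[OF assms(1)[unfolded computable2_def] computable_pair[OF assms(2,3)]]
  by simp

lemmas computable_intros = computable_basic computable_add computable_mult computable_diff
  computable_if_zero computable_funpow

text \<open>
  The first conjunct, with an arbitrary uniformly computable family of oracles instead of a fixed
  coding of finite oracles, is preserved when the oracle is itself transformed by an effective
  functional.
\<close>

definition effective :: "((nat \<Rightarrow> nat) \<Rightarrow> nat \<Rightarrow> nat) \<Rightarrow> bool" where
  "effective F \<longleftrightarrow> (\<forall>A. computable2 A \<longrightarrow> computable2 (\<lambda>s. F (A s))) \<and>
     (\<forall>h x. \<exists>N. \<forall>h'. (\<forall>i<N. h' i = h i) \<longrightarrow> F h' x = F h x)"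

lemma effectiveI:
  assumes "\<And>A. computable2 A \<Longrightarrow> computable (\<lambda>y. F (A (pfst y)) (psnd y))"
    and "\<And>h x. \<exists>N. \<forall>h'. (\<forall>i<N. h' i = h i) \<longrightarrow> F h' x = F h x"
  shows "effective F"
  using assms by (simp add: effective_def computable2_def)

lemma effective_computable:
  assumes "effective F" "computable2 A" "computable f" "computable g"
  shows "computable (\<lambda>x. F (A (f x)) (g x))"
  using assms computable2_comp[of "\<lambda>s. F (A s)"] by (simp add: effective_def)

lemma effective_modulus:
  "effective F \<Longrightarrow> \<exists>N. \<forall>h'. (\<forall>i<N. h' i = h i) \<longrightarrow> F h' x = F h x"
  by (simp add: effective_def)

lemma effective_input: "effective (\<lambda>h x. x)"
  by (rule effectiveI) (auto intro: computable_basic)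

lemma effective_comp:
  assumes "computable f" "effective a"
  shows "effective (\<lambda>h x. f (a h x))"
proof (rule effectiveI)
  show "computable (\<lambda>y. f (a (A (pfst y)) (psnd y)))" if "computable2 A" for A
    by (intro computable_comp[OF assms(1)] effective_computable[OF assms(2) that] computable_basic)
  show "\<exists>N. \<forall>h'. (\<forall>i<N. h' i = h i) \<longrightarrow> f (a h' x) = f (a h x)" for h x
    using effective_modulus[OF assms(2), of h x] by metis
qed

lemma effective_pair:
  assumes "effective a" "effective b"
  shows "effective (\<lambda>h x. pair (a h x) (b h x))"
proof (rule effectiveI)
  show "computable (\<lambda>y. pair (a (A (pfst y)) (psnd y)) (b (A (pfst y)) (psnd y)))"
    if "computable2 A" for A
    by (intro effective_computable[OF assms(1) that] effective_computable[OF assms(2) that]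
        computable_basic)
  show "\<exists>N. \<forall>h'. (\<forall>i<N. h' i = h i) \<longrightarrow> pair (a h' x) (b h' x) = pair (a h x) (b h x)" for h x
  proof -
    obtain M where M: "\<forall>h'. (\<forall>i<M. h' i = h i) \<longrightarrow> a h' x = a h x"
      using effective_modulus[OF assms(1), of h x] by blast
    obtain N where N: "\<forall>h'. (\<forall>i<N. h' i = h i) \<longrightarrow> b h' x = b h x"
      using effective_modulus[OF assms(2), of h x] by blast
    show ?thesis
      by (intro exI[of _ "max M N"] allI impI arg_cong2[where f = "\<lambda>a b. pair a b"]
          M[rule_format] N[rule_format]) auto
  qed
qed

lemma effective_const: "effective (\<lambda>h x. n)"
  using effective_comp[OF computable_const effective_input] .

lemma effective_pfst: "effective a \<Longrightarrow> effective (\<lambda>h x. pfst (a h x))"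
  and effective_psnd: "effective a \<Longrightarrow> effective (\<lambda>h x. psnd (a h x))"
  and effective_Suc: "effective a \<Longrightarrow> effective (\<lambda>h x. Suc (a h x))"
  by (rule effective_comp[where a = a]; simp add: computable_basic)+

lemma effective_comp2:
  assumes "computable2 A" "effective a" "effective b"
  shows "effective (\<lambda>h x. A (a h x) (b h x))"
  using effective_comp[OF assms(1)[unfolded computable2_def] effective_pair[OF assms(2,3)]]
  by simp

lemma effective_arith:
  assumes "effective a" "effective b"
  shows "effective (\<lambda>h x. a h x + b h x)" "effective (\<lambda>h x. a h x * b h x)"
    "effective (\<lambda>h x. a h x - b h x)"
  by (rule effective_comp2[OF _ assms]; simp add: computable2_def computable_intros)+

lemma effective_if_zero:
  assumes "effective c" "effective a" "effective b"
  shows "effective (\<lambda>h x. if c h x = 0 then a h x else b h x)"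
  using effective_comp[OF _ effective_pair[OF assms(1) effective_pair[OF assms(2,3)]],
      of "\<lambda>y. if pfst y = 0 then pfst (psnd y) else psnd (psnd y)"]
  by (simp add: computable_intros cong: if_cong)

lemma effective_oracle:
  assumes "effective a"
  shows "effective (\<lambda>h x. h (a h x))"
proof (rule effectiveI)
  show "computable (\<lambda>y. A (pfst y) (a (A (pfst y)) (psnd y)))" if "computable2 A" for A
    by (intro computable2_comp[OF that] effective_computable[OF assms that] computable_basic)
  show "\<exists>N. \<forall>h'. (\<forall>i<N. h' i = h i) \<longrightarrow> h' (a h' x) = h (a h x)" for h x
  proof -
    obtain M where M: "\<forall>h'. (\<forall>i<M. h' i = h i) \<longrightarrow> a h' x = a h x"
      using effective_modulus[OF assms, of h x] by blast
    show ?thesis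
    proof (intro exI[of _ "max M (Suc (a h x))"] allI impI)
      fix h' assume eq: "\<forall>i<max M (Suc (a h x)). h' i = h i"
      then have "a h' x = a h x" by (intro M[rule_format]) auto
      with eq show "h' (a h' x) = h (a h x)" by simp
    qed
  qed
qed

text \<open>Lets the oracle be rewritten in a way that may depend on the input \<open>x\<close>,
  which the quantifier steps require. For continuity, \<open>F\<close> reads finitely many entries
  of the new oracle, and each of these depends on finitely many entries of \<open>h\<close>.\<close>

lemma effective_subst:
  assumes "effective F" "effective T" "effective a"
  shows "effective (\<lambda>h x. F (\<lambda>j. T h (pair x j)) (a h x))"
proof (rule effectiveI)
  fix A assume A: "computable2 A"
  \<comment> \<open>The new family is indexed by pairs of an old index and an input.\<close>
  have "computable2 (\<lambda>y j. T (A (pfst y)) (pair (psnd y) j))"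
    unfolding computable2_def by (intro effective_computable[OF assms(2) A] computable_basic)
  from effective_computable[OF assms(1) this computable_id effective_computable[OF assms(3) A]]
  show "computable (\<lambda>y. F (\<lambda>j. T (A (pfst y)) (pair (psnd y) j)) (a (A (pfst y)) (psnd y)))"
    by (simp add: computable_basic)
next
  fix h x
  obtain M where M: "\<forall>h'. (\<forall>i<M. h' i = h i) \<longrightarrow> a h' x = a h x"
    using effective_modulus[OF assms(3), of h x] by blast
  obtain K where K: "\<forall>g. (\<forall>i<K. g i = T h (pair x i)) \<longrightarrow>
      F g (a h x) = F (\<lambda>j. T h (pair x j)) (a h x)"
    using effective_modulus[OF assms(1), of "\<lambda>j. T h (pair x j)" "a h x"] by blast
  have "\<exists>N. \<forall>h'. (\<forall>i<N. h' i = h i) \<longrightarrow> T h' (pair x j) = T h (pair x j)" for j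
    by (rule effective_modulus[OF assms(2)])
  then obtain N where N: "\<And>j h'. (\<forall>i<N j. h' i = h i) \<Longrightarrow> T h' (pair x j) = T h (pair x j)"
    by metis
  \<comment> \<open>The sum serves as a common bound for the finitely many moduli.\<close>
  have le: "N j \<le> sum N {..<K}" if "j < K" for j
    using that by (intro member_le_sum) auto
  show "\<exists>N. \<forall>h'. (\<forall>i<N. h' i = h i) \<longrightarrow>
      F (\<lambda>j. T h' (pair x j)) (a h' x) = F (\<lambda>j. T h (pair x j)) (a h x)"
  proof (intro exI[of _ "M + sum N {..<K}"] allI impI)
    fix h' assume eq: "\<forall>i<M + sum N {..<K}. h' i = h i"
    then have "a h' x = a h x" by (intro M[rule_format]) auto
    moreover have "F (\<lambda>j. T h' (pair x j)) (a h x) = F (\<lambda>j. T h (pair x j)) (a h x)"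
    proof (rule K[rule_format])
      show "T h' (pair x j) = T h (pair x j)" if "j < K" for j
        using eq le[OF that] by (intro N) auto
    qed
    ultimately show "F (\<lambda>j. T h' (pair x j)) (a h' x) = F (\<lambda>j. T h (pair x j)) (a h x)"
      by (simp only:)
  qed
qed

lemmas effective_intros = effective_input effective_const effective_pair effective_pfst
  effective_psnd effective_Suc effective_arith effective_if_zero effective_oracle

section \<open>A normal form for arithmetical predicates\<close>

text \<open>A number codes an environment through its right-nested pairs, all of them used.\<close>

primrec lookup :: "nat \<Rightarrow> nat \<Rightarrow> nat" where
  "lookup 0 w = pfst w"
| "lookup (Suc i) w = lookup i (psnd w)"

primrec upd :: "nat \<Rightarrow> nat \<Rightarrow> nat \<Rightarrow> nat" where
  "upd 0 w m = pair m (psnd w)"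
| "upd (Suc i) w m = pair (pfst w) (upd i (psnd w) m)"

definition env :: "nat \<Rightarrow> nat \<Rightarrow> nat" where
  "env w i = lookup i w"

lemma env_upd: "env (upd i w m) = (env w)(i := m)"
proof -
  have "lookup j (upd i w m) = (if j = i then m else lookup j w)" for j
  proof (induction i arbitrary: w j)
    case 0
    then show ?case by (cases j) auto
  next
    case (Suc i)
    then show ?case by (cases j) auto
  qed
  then show ?thesis by (auto simp: env_def)
qed

lemma prod_decode_0: "prod_decode 0 = (0, 0)"
  by (simp add: prod_decode_def prod_decode_aux.simps)

lemma env_single: "env (pair n 0) = (\<lambda>_. 0)(0 := n)"
proof -
  have "lookup i 0 = 0" for i
    by (induction i) (auto simp: prod_decode_0)
  then have "lookup i (pair n 0) = (if i = 0 then n else 0)" for i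
    by (cases i) auto
  then show ?thesis by (auto simp: env_def)
qed

lemma computable_lookup: "computable f \<Longrightarrow> computable (\<lambda>x. lookup i (f x))"
  by (induction i arbitrary: f) (simp_all add: computable_basic)

lemma computable_upd:
  "computable f \<Longrightarrow> computable g \<Longrightarrow> computable (\<lambda>x. upd i (f x) (g x))"
  by (induction i arbitrary: f) (simp_all add: computable_basic)

lemma effective_upd:
  assumes "effective a" "effective b"
  shows "effective (\<lambda>h x. upd i (a h x) (b h x))"
  by (rule effective_comp2[OF _ assms])
    (simp add: computable2_def computable_upd computable_basic)

text \<open>The oracle pairs \<open>f\<close> with a witness function, so \<open>Fun\<close> reads
  first components; the environment is the first half of the input.\<close>

lemma effective_tval: "effective (\<lambda>h x. tval (\<lambda>i. pfst (h i)) (env (pfst x)) t)"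
proof (induction t)
  case (Var i)
  show ?case
    using effective_comp[OF computable_lookup[OF computable_pfst[OF computable_id]] effective_input, of i]
    by (simp add: env_def)
qed (simp_all add: effective_intros)

text \<open>The form "exists \<open>g\<close>, for all \<open>k\<close>" with an effective matrix: a
  single function witness and a single universal number quantifier, with \<open>f\<close> and
  \<open>g\<close> merged into one oracle.\<close>

definition normal_form :: "((nat \<Rightarrow> nat) \<Rightarrow> (nat \<Rightarrow> nat) \<Rightarrow> bool) \<Rightarrow> bool" where
  "normal_form P \<longleftrightarrow> (\<exists>F. effective F \<and>
     (\<forall>f w. P f (env w) \<longleftrightarrow> (\<exists>g. \<forall>k. F (\<lambda>i. pair (f i) (g i)) (pair w k) = 0)))"

section \<open>Closure of the normal form under connectives and quantifiers\<close>

lemma normal_form_Eq: "normal_form (\<lambda>f e. tval f e t = tval f e u)"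
  and normal_form_neq: "normal_form (\<lambda>f e. tval f e t \<noteq> tval f e u)"
proof -
  \<comment> \<open>With truncated subtraction this is 0 exactly when the two values agree, and
    \<open>1 - F\<close> reverses the test.\<close>
  define F where "F h x =
    (let a = tval (\<lambda>i. pfst (h i)) (env (pfst x)) t;
         b = tval (\<lambda>i. pfst (h i)) (env (pfst x)) u in (a - b) + (b - a))" for h x
  have eff: "effective F"
    unfolding F_def Let_def by (intro effective_intros effective_tval)
  have F: "F (\<lambda>i. pair (f i) (g i)) (pair w k) = 0 \<longleftrightarrow> tval f (env w) t = tval f (env w) u" for f g w k
    by (auto simp: F_def Let_def)
  show "normal_form (\<lambda>f e. tval f e t = tval f e u)"
    unfolding normal_form_def by (intro exI[of _ F]) (simp add: eff F)
  have "effective (\<lambda>h x. 1 - F h x)"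
    by (intro effective_intros eff)
  moreover have "1 - F (\<lambda>i. pair (f i) (g i)) (pair w k) = 0 \<longleftrightarrow>
      tval f (env w) t \<noteq> tval f (env w) u" for f g w k
    by (simp add: F[symmetric, of f w g k] Suc_le_eq)
  ultimately show "normal_form (\<lambda>f e. tval f e t \<noteq> tval f e u)"
    unfolding normal_form_def by (intro exI[of _ "\<lambda>h x. 1 - F h x"]) simp
qed

lemma ex_pair_seq: "(\<exists>g. P (\<lambda>i. pfst (g i)) (\<lambda>i. psnd (g i))) \<longleftrightarrow> (\<exists>a b. P a b)"
proof
  assume "\<exists>a b. P a b"
  then obtain a b where "P a b" by blast
  then show "\<exists>g. P (\<lambda>i. pfst (g i)) (\<lambda>i. psnd (g i))"
    by (intro exI[of _ "\<lambda>i. pair (a i) (b i)"]) simp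
qed blast

text \<open>One function carries both witnesses as its components; \<open>S\<close> and
  \<open>T\<close> recover the two oracles.\<close>

lemma normal_form_conj:
  assumes "normal_form P" "normal_form Q"
  shows "normal_form (\<lambda>f e. P f e \<and> Q f e)"
proof -
  obtain F where F: "effective F"
    "\<And>f w. P f (env w) \<longleftrightarrow> (\<exists>g. \<forall>k. F (\<lambda>i. pair (f i) (g i)) (pair w k) = 0)"
    using assms(1) unfolding normal_form_def by blast
  obtain G where G: "effective G"
    "\<And>f w. Q f (env w) \<longleftrightarrow> (\<exists>g. \<forall>k. G (\<lambda>i. pair (f i) (g i)) (pair w k) = 0)"
    using assms(2) unfolding normal_form_def by blast
  define S where "S h z = pair (pfst (h (psnd z))) (pfst (psnd (h (psnd z))))" for h :: "nat \<Rightarrow> nat" and z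
  define T where "T h z = pair (pfst (h (psnd z))) (psnd (psnd (h (psnd z))))" for h :: "nat \<Rightarrow> nat" and z
  define H where "H h x = F (\<lambda>j. S h (pair x j)) x + G (\<lambda>j. T h (pair x j)) x" for h x
  have "effective S" "effective T"
    unfolding S_def T_def by (intro effective_intros)+
  then have "effective H"
    unfolding H_def
    by (intro effective_arith effective_subst[OF F(1) \<open>effective S\<close>]
        effective_subst[OF G(1) \<open>effective T\<close>] effective_input)
  moreover have "P f (env w) \<and> Q f (env w) \<longleftrightarrow>
      (\<exists>g. \<forall>k. H (\<lambda>i. pair (f i) (g i)) (pair w k) = 0)" for f w
    unfolding F(2) G(2) H_def S_def T_def
    using ex_pair_seq[of "\<lambda>a b. (\<forall>k. F (\<lambda>i. pair (f i) (a i)) (pair w k) = 0) \<and>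
      (\<forall>k. G (\<lambda>i. pair (f i) (b i)) (pair w k) = 0)"]
    by (simp add: all_conj_distrib)
  ultimately show ?thesis unfolding normal_form_def by blast
qed

lemma ex_tagged_seq: "(\<exists>g. P (pfst (g 0)) (\<lambda>i. psnd (g i))) \<longleftrightarrow> (\<exists>m a. P m a)"
proof
  assume "\<exists>m a. P m a"
  then obtain m a where "P m a" by blast
  then show "\<exists>g. P (pfst (g 0)) (\<lambda>i. psnd (g i))"
    by (intro exI[of _ "\<lambda>i. pair m (a i)"]) simp
qed blast

text \<open>The first component of \<open>g 0\<close> announces which disjunct holds; the second
  components are the witness for it.\<close>

lemma normal_form_disj:
  assumes "normal_form P" "normal_form Q"
  shows "normal_form (\<lambda>f e. P f e \<or> Q f e)"
proof -
  obtain F where F: "effective F"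
    "\<And>f w. P f (env w) \<longleftrightarrow> (\<exists>g. \<forall>k. F (\<lambda>i. pair (f i) (g i)) (pair w k) = 0)"
    using assms(1) unfolding normal_form_def by blast
  obtain G where G: "effective G"
    "\<And>f w. Q f (env w) \<longleftrightarrow> (\<exists>g. \<forall>k. G (\<lambda>i. pair (f i) (g i)) (pair w k) = 0)"
    using assms(2) unfolding normal_form_def by blast
  define T where "T h z = pair (pfst (h (psnd z))) (psnd (psnd (h (psnd z))))" for h :: "nat \<Rightarrow> nat" and z
  define H where "H h x = (if pfst (psnd (h 0)) = 0 then F (\<lambda>j. T h (pair x j)) x
    else G (\<lambda>j. T h (pair x j)) x)" for h x
  have "effective T"
    unfolding T_def by (intro effective_intros)
  then have "effective H"
    unfolding H_def
    by (intro effective_if_zero effective_subst[OF F(1) \<open>effective T\<close>]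
        effective_subst[OF G(1) \<open>effective T\<close>]) (intro effective_intros)+
  moreover have "P f (env w) \<or> Q f (env w) \<longleftrightarrow>
      (\<exists>g. \<forall>k. H (\<lambda>i. pair (f i) (g i)) (pair w k) = 0)" for f w
  proof -
    have "(\<exists>g. \<forall>k. H (\<lambda>i. pair (f i) (g i)) (pair w k) = 0) \<longleftrightarrow>
      (\<exists>m a. \<forall>k. (if m = (0::nat) then F (\<lambda>i. pair (f i) (a i)) (pair w k)
        else G (\<lambda>i. pair (f i) (a i)) (pair w k)) = 0)"
      unfolding H_def T_def by (subst ex_tagged_seq[symmetric]) simp
    also have "\<dots> \<longleftrightarrow> P f (env w) \<or> Q f (env w)" (is "(\<exists>m a. ?R m a) \<longleftrightarrow> _")
    proof
      assume "\<exists>m a. ?R m a"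
      then obtain m a where "?R m a" by blast
      then show "P f (env w) \<or> Q f (env w)"
        unfolding F(2) G(2) by (cases "m = 0") auto
    next
      assume "P f (env w) \<or> Q f (env w)"
      then obtain a where "?R 0 a \<or> ?R 1 a"
        unfolding F(2) G(2) by auto
      then show "\<exists>m a. ?R m a" by blast
    qed
    finally show ?thesis by simp
  qed
  ultimately show ?thesis unfolding normal_form_def by blast
qed

lemma all_pair: "(\<forall>x. P x) \<longleftrightarrow> (\<forall>a b. P (pair a b))"
  by (metis prod.collapse prod_decode_inverse)

text \<open>By choice, witnesses for the various \<open>m\<close> form one function read at
  \<open>pair m j\<close>, and the two number quantifiers merge into one.\<close>

lemma normal_form_all:
  assumes "normal_form P"
  shows "normal_form (\<lambda>f e. \<forall>m. P f (e(i := m)))"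
proof -
  obtain F where F: "effective F"
    "\<And>f w. P f (env w) \<longleftrightarrow> (\<exists>g. \<forall>k. F (\<lambda>i. pair (f i) (g i)) (pair w k) = 0)"
    using assms(1) unfolding normal_form_def by blast
  \<comment> \<open>Here \<open>z\<close> is \<open>pair (pair w (pair m k)) j\<close>, so the inner
    projections extract \<open>m\<close> and \<open>j\<close>.\<close>
  define T where "T h z = pair (pfst (h (psnd z))) (psnd (h (pair (pfst (psnd (pfst z))) (psnd z))))"
    for h :: "nat \<Rightarrow> nat" and z
  define H where "H h x = F (\<lambda>j. T h (pair x j))
    (pair (upd i (pfst x) (pfst (psnd x))) (psnd (psnd x)))" for h x
  have "effective T"
    unfolding T_def by (intro effective_intros)
  then have "effective H"
    unfolding H_def
    by (intro effective_subst[OF F(1) \<open>effective T\<close>] effective_intros effective_upd)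
  moreover have "(\<forall>m. P f ((env w)(i := m))) \<longleftrightarrow>
      (\<exists>g. \<forall>k. H (\<lambda>i. pair (f i) (g i)) (pair w k) = 0)" for f w
  proof -
    have H: "H (\<lambda>i. pair (f i) (g i)) (pair w (pair m k)) =
        F (\<lambda>j. pair (f j) (g (pair m j))) (pair (upd i w m) k)" for g m k
      by (simp add: H_def T_def)
    have "(\<exists>g. \<forall>k. H (\<lambda>i. pair (f i) (g i)) (pair w k) = 0) \<longleftrightarrow>
        (\<exists>g. \<forall>m k. H (\<lambda>i. pair (f i) (g i)) (pair w (pair m k)) = 0)"
      by (intro arg_cong[where f = Ex] ext all_pair)
    also have "\<dots> \<longleftrightarrow> (\<exists>g. \<forall>m k. F (\<lambda>j. pair (f j) (g (pair m j))) (pair (upd i w m) k) = 0)"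
      by (simp only: H)
    also have "\<dots> \<longleftrightarrow> (\<forall>m. \<exists>g. \<forall>k. F (\<lambda>j. pair (f j) (g j)) (pair (upd i w m) k) = 0)"
      (is "?L \<longleftrightarrow> ?R")
    proof
      assume ?R
      then obtain g where g: "\<And>m k. F (\<lambda>j. pair (f j) (g m j)) (pair (upd i w m) k) = 0"
        by metis
      show ?L
        by (rule exI[of _ "\<lambda>z. g (pfst z) (psnd z)"]) (simp add: g)
    next
      assume ?L
      then obtain g where "\<And>m k. F (\<lambda>j. pair (f j) (g (pair m j))) (pair (upd i w m) k) = 0"
        by blast
      then show ?R by (intro allI exI)
    qed
    also have "\<dots> \<longleftrightarrow> (\<forall>m. P f ((env w)(i := m)))"
      by (simp only: F(2)[symmetric] env_upd)
    finally show ?thesis by simp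
  qed
  ultimately show ?thesis unfolding normal_form_def by blast
qed

lemma normal_form_ex:
  assumes "normal_form P"
  shows "normal_form (\<lambda>f e. \<exists>m. P f (e(i := m)))"
proof -
  obtain F where F: "effective F"
    "\<And>f w. P f (env w) \<longleftrightarrow> (\<exists>g. \<forall>k. F (\<lambda>i. pair (f i) (g i)) (pair w k) = 0)"
    using assms(1) unfolding normal_form_def by blast
  define T where "T h z = pair (pfst (h (psnd z))) (psnd (psnd (h (psnd z))))" for h :: "nat \<Rightarrow> nat" and z
  define H where "H h x = F (\<lambda>j. T h (pair x j))
    (pair (upd i (pfst x) (pfst (psnd (h 0)))) (psnd x))" for h x
  have "effective T"
    unfolding T_def by (intro effective_intros)
  then have "effective H"
    unfolding H_def
    by (intro effective_subst[OF F(1) \<open>effective T\<close>] effective_intros effective_upd)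
  moreover have "(\<exists>m. P f ((env w)(i := m))) \<longleftrightarrow>
      (\<exists>g. \<forall>k. H (\<lambda>i. pair (f i) (g i)) (pair w k) = 0)" for f w
    unfolding env_upd[symmetric] F(2) H_def T_def
    by (subst ex_tagged_seq[symmetric]) simp
  ultimately show ?thesis unfolding normal_form_def by blast
qed

text \<open>A formula and its negation are treated together, since \<open>Neg\<close> exchanges the
  two claims.\<close>

lemma normal_form_sat:
  "normal_form (\<lambda>f e. sat f e p) \<and> normal_form (\<lambda>f e. \<not> sat f e p)"
proof (induction p)
  case (Conj p q)
  then show ?case by (simp only: sat.simps de_Morgan_conj normal_form_conj normal_form_disj)
next
  case (Forall i p)
  then show ?case
    using normal_form_all[of "\<lambda>f e. sat f e p" i] normal_form_ex[of "\<lambda>f e. \<not> sat f e p" i] by simp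
qed (simp_all add: normal_form_Eq normal_form_neq)

lemma Pi11_normal_form:
  assumes "Pi11 B"
  obtains F where "effective F" "\<And>n. n \<notin> B \<longleftrightarrow> (\<exists>h. \<forall>k. F h (pair n k) = 0)"
proof -
  obtain p where p: "\<And>n. n \<in> B \<longleftrightarrow> (\<forall>f. sat f ((\<lambda>_. 0)(0 := n)) p)"
    using assms unfolding Pi11_def by blast
  obtain F where F: "effective F" "\<And>f w. \<not> sat f (env w) p \<longleftrightarrow>
      (\<exists>g. \<forall>k. F (\<lambda>i. pair (f i) (g i)) (pair w k) = 0)"
    using normal_form_sat[of p] unfolding normal_form_def by blast
  \<comment> \<open>\<open>psnd (pair x j)\<close> is just \<open>j\<close>, written to fit
    \<open>effective_subst\<close>; \<open>pair (pfst x) 0\<close> codes the environment with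
    \<open>n\<close> at variable 0 and 0 elsewhere.\<close>
  define G where "G h x = F (\<lambda>j. h (psnd (pair x j))) (pair (pair (pfst x) 0) (psnd x))" for h x
  have "effective G"
    unfolding G_def
    by (intro effective_subst[OF F(1), of "\<lambda>h z. h (psnd z)"] effective_intros)
  moreover have "n \<notin> B \<longleftrightarrow> (\<exists>h. \<forall>k. G h (pair n k) = 0)" for n
  proof -
    have "n \<notin> B \<longleftrightarrow> (\<exists>f g. \<forall>k. F (\<lambda>i. pair (f i) (g i)) (pair (pair n 0) k) = 0)"
      using F(2)[of _ "pair n 0"] by (auto simp: p env_single)
    also have "\<dots> \<longleftrightarrow> (\<exists>h. \<forall>k. F (\<lambda>i. pair (pfst (h i)) (psnd (h i))) (pair (pair n 0) k) = 0)"
      by (subst ex_pair_seq[symmetric]) simp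
    finally show ?thesis by (simp add: G_def)
  qed
  ultimately show thesis by (rule that)
qed

section \<open>Paths through a computable tree\<close>

text \<open>The newest entry is outermost, so passing to a child is a single pairing.\<close>

primrec hist :: "(nat \<Rightarrow> nat) \<Rightarrow> nat \<Rightarrow> nat" where
  "hist z 0 = 0"
| "hist z (Suc l) = pair (z l) (hist z l)"

definition entry :: "nat \<Rightarrow> nat \<Rightarrow> nat" where
  "entry w k = pfst ((psnd ^^ (pfst w - 1 - k)) (psnd w))"

lemma entry_hist: "k < l \<Longrightarrow> entry (pair l (hist z l)) k = z k"
proof (induction l)
  case (Suc l)
  show ?case
  proof (cases "k = l")
    case True
    then show ?thesis by (simp add: entry_def)
  next
    case False
    then have "Suc l - 1 - k = Suc (l - 1 - k)" using Suc.prems by auto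
    moreover have "(psnd ^^ Suc m) (pair a b) = (psnd ^^ m) b" for m a b
      by (simp add: funpow_Suc_right del: funpow.simps)
    ultimately show ?thesis
      using Suc False by (simp add: entry_def del: funpow.simps)
  qed
qed simp

text \<open>
  A node \<open>pair l s\<close> is a sequence of length \<open>l\<close> whose entries are pairs of a value of the
  oracle and a claimed modulus of continuity of \<open>F\<close> at \<open>pair n k\<close>. The equation for \<open>k\<close> is tested at
  all lengths \<open>l = pair k j\<close>, but only once \<open>l\<close> reaches the claimed modulus: otherwise the
  finite part of a good oracle could be rejected. Only nonempty sequences are tested, so that
  \<open>k < l\<close> and the entry for \<open>k\<close> is present.
\<close>

definition alarm :: "((nat \<Rightarrow> nat) \<Rightarrow> nat \<Rightarrow> nat) \<Rightarrow> nat \<Rightarrow> nat \<Rightarrow> nat" where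
  "alarm F n w = (Suc (pfst w) - psnd (entry w (pfst (pfst w)))) *
     F (\<lambda>i. pfst (entry w i)) (pair n (pfst (pfst w)))"

text \<open>The node itself indexes the family of oracles on which \<open>F\<close> is
  evaluated.\<close>

lemma computable2_alarm:
  assumes "effective F"
  shows "computable2 (alarm F)"
proof -
  have entry: "computable2 entry"
    unfolding computable2_def entry_def by (intro computable_intros)
  then have fst_entry: "computable2 (\<lambda>w i. pfst (entry w i))"
    unfolding computable2_def by (rule computable_pfst)
  show ?thesis
    unfolding computable2_def alarm_def
    by (intro computable_mult computable_diff computable_basic computable2_comp[OF entry]
        effective_computable[OF assms fst_entry])
qed

lemma less_pair: "0 < pair k j \<Longrightarrow> k < pair k j"
  by (cases j; cases k) (auto simp: prod_encode_def)

lemma pfst_less: "0 < l \<Longrightarrow> pfst l < l"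
  using less_pair[of "pfst l" "psnd l"] by simp

text \<open>A good oracle becomes a path by attaching true moduli. Conversely, the equation for each
  \<open>k\<close> is tested at infinitely many lengths, and one long enough settles it.\<close>

lemma path_iff:
  assumes "effective F"
  shows "(\<exists>h. \<forall>k. F h (pair n k) = 0) \<longleftrightarrow>
    (\<exists>z. \<forall>l. alarm F n (pair (Suc l) (hist z (Suc l))) = 0)"
proof
  assume "\<exists>h. \<forall>k. F h (pair n k) = 0"
  then obtain h where h: "\<And>k. F h (pair n k) = 0" by blast
  have "\<forall>k. \<exists>N. \<forall>h'. (\<forall>i<N. h' i = h i) \<longrightarrow> F h' (pair n k) = F h (pair n k)"
    by (intro allI effective_modulus[OF assms])
  from choice[OF this] obtain N where
    N: "\<forall>k h'. (\<forall>i<N k. h' i = h i) \<longrightarrow> F h' (pair n k) = F h (pair n k)"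
    by blast
  define z where "z k = pair (h k) (N k)" for k
  have "alarm F n (pair l (hist z l)) = 0" if "0 < l" for l
  proof -
    let ?k = "pfst l"
    have "psnd (entry (pair l (hist z l)) ?k) = N ?k"
      using entry_hist[OF pfst_less[OF that]] by (simp add: z_def)
    moreover have "F (\<lambda>i. pfst (entry (pair l (hist z l)) i)) (pair n ?k) = 0" if "N ?k \<le> l"
      using that h by (subst N[rule_format]) (auto simp: entry_hist z_def)
    \<comment> \<open>Below the claimed modulus the truncated first factor of \<open>alarm\<close>
      is 0.\<close>
    ultimately show ?thesis by (cases "N ?k \<le> l") (auto simp: alarm_def)
  qed
  then show "\<exists>z. \<forall>l. alarm F n (pair (Suc l) (hist z (Suc l))) = 0" by blast
next
  assume "\<exists>z. \<forall>l. alarm F n (pair (Suc l) (hist z (Suc l))) = 0"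
  then obtain z where z: "\<And>l. alarm F n (pair (Suc l) (hist z (Suc l))) = 0" by blast
  have "F (\<lambda>i. pfst (z i)) (pair n k) = 0" for k
  proof -
    obtain N where N: "\<forall>h'. (\<forall>i<N. h' i = pfst (z i)) \<longrightarrow>
        F h' (pair n k) = F (\<lambda>i. pfst (z i)) (pair n k)"
      using effective_modulus[OF assms, of "\<lambda>i. pfst (z i)" "pair n k"] by blast
    \<comment> \<open>A path may claim false moduli, so \<open>l\<close> must pass both the true and
      the claimed one; \<open>Suc\<close> makes it positive, so that \<open>k < l\<close>.\<close>
    define l where "l = pair k (Suc (N + psnd (z k)))"
    have l: "k < l" "N \<le> l" "psnd (z k) \<le> l" "pfst l = k"
      using less_pair[of k "Suc (N + psnd (z k))"] le_prod_encode_2[of "Suc (N + psnd (z k))" k]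
      by (auto simp: l_def)
    have "alarm F n (pair l (hist z l)) = 0"
      using z[of "l - 1"] l(1) by (simp del: hist.simps)
    then have "F (\<lambda>i. pfst (entry (pair l (hist z l)) i)) (pair n k) = 0"
      using l by (auto simp: alarm_def entry_hist)
    then show ?thesis
      using l(2) by (subst (asm) N[rule_format]) (auto simp: entry_hist)
  qed
  then show "\<exists>h. \<forall>k. F h (pair n k) = 0" by (intro exI[of _ "\<lambda>i. pfst (z i)"]) blast
qed

section \<open>Hardness\<close>

primrec const_prog :: "nat \<Rightarrow> prog" where
  "const_prog 0 = Zero"
| "const_prog (Suc n) = Comp Succ (const_prog n)"

lemma run_const_prog: "run (const_prog n) x = Some n"
  by (induction n) auto

lemma const_prog_inj: "const_prog m = const_prog n \<longleftrightarrow> m = n"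
  by (metis option.inject run_const_prog)

text \<open>The code of \<open>e\<close> composed with the map from \<open>x\<close> to
  \<open>pair q x\<close>; \<open>Pair Fst Snd\<close> is the identity.\<close>

definition smn :: "nat \<Rightarrow> nat \<Rightarrow> nat" where
  "smn e q = 5 + 4 * pair e (prog_encode (Pair (const_prog q) (Pair Fst Snd)))"

text \<open>Constant programs with different outputs differ, and codes are injective. This later
  keeps the two elements at a node distinct.\<close>

lemma smn_inj: "smn e q = smn e r \<longleftrightarrow> q = r"
proof
  assume "smn e q = smn e r"
  then have "pair e (prog_encode (Pair (const_prog q) (Pair Fst Snd))) =
      pair e (prog_encode (Pair (const_prog r) (Pair Fst Snd)))"
    by (simp only: smn_def)
  then have "Pair (const_prog q) (Pair Fst Snd) = Pair (const_prog r) (Pair Fst Snd)"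
    by (metis prog_encode_inj prod_encode_eq prod.inject)
  then show "q = r" by (simp add: const_prog_inj)
qed simp

lemma Phi_smn: "Phi (smn e q) x = Phi e (pair q x)"
proof -
  obtain c where c: "prog_encode c = e" using prog_encode_surj by blast
  have "smn e q = prog_encode (Comp c (Pair (const_prog q) (Pair Fst Snd)))"
    by (simp add: smn_def c)
  then have "Phi (smn e q) = run (Comp c (Pair (const_prog q) (Pair Fst Snd)))"
    by (simp only: Phi_prog_encode)
  moreover have "Phi e = run c"
    by (simp only: Phi_prog_encode flip: c)
  ultimately show ?thesis by (simp add: run_const_prog)
qed

lemma computable2_smn: "computable2 smn"
proof -
  \<comment> \<open>Each further \<open>Comp Succ\<close> applies one fixed computable map to the
    code, so the code is an iterate.\<close>
  have rec: "prog_encode (const_prog q) = ((\<lambda>b. 5 + 4 * pair 1 b) ^^ q) 0" for q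
    by (induction q) auto
  have "computable (\<lambda>b. 5 + 4 * pair 1 b)" by (intro computable_intros)
  then show ?thesis
    unfolding computable2_def smn_def prog_encode.simps rec by (intro computable_intros)
qed

text \<open>
  The program \<open>D\<close> is given its own code \<open>e\<close> as part of the input, so that it can compute the codes
  of its specialisations.
\<close>

lemma ex_node_codes:
  assumes "computable c" "computable2 step"
  obtains v where "computable v" "inj v"
    "\<And>w x. Phi (v w) x = Some (if c (step w x) = 0 then v (step w x) else 0)"
proof -
  define D where "D y =
    (let e = pfst (pfst y); w = step (psnd (pfst y)) (psnd y) in
      if c w = 0 then smn e (pair e w) else 0)" for y
  have "computable D"
    unfolding D_def Let_def
    by (intro computable_intros computable2_comp[OF computable2_smn] computable2_comp[OF assms(2)]
        computable_comp[OF assms(1)])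
  then obtain e where e: "\<And>x. Phi e x = Some (D x)" by (auto simp: computable_def)
  \<comment> \<open>Supplying \<open>e\<close> with its own code replaces an appeal to the recursion
    theorem.\<close>
  define v where "v w = smn e (pair e w)" for w
  show thesis
  proof (rule that[of v])
    show "computable v"
      unfolding v_def by (intro computable2_comp[OF computable2_smn] computable_intros)
    show "inj v" by (auto simp: inj_def v_def smn_inj)
    show "Phi (v w) x = Some (if c (step w x) = 0 then v (step w x) else 0)" for w x
      by (simp add: v_def[of w] Phi_smn e D_def) (simp add: v_def)
  qed
qed

text \<open>Application sees only values, so an applied node can be exchanged for the element naming
  its child.\<close>

lemma eqv_cong:
  assumes "eqv app s t" "val app s = val app s'" "val app t = val app t'"
  shows "eqv app s' t'"
  using assms
proof (induction arbitrary: s' t' rule: eqv.induct)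
  case (eqv_base s t)
  then show ?case by (auto intro!: eqv.eqv_base simp: kleene_eq_def)
next
  case (eqv_step s t)
  show ?case by (rule eqv.eqv_step) (rule eqv_step.IH, simp_all add: eqv_step.prems)
qed

lemma eqv_iff_no_path:
  assumes node: "\<And>i l s x. K1 (v i l s) x =
      Some (if A (Suc l) (pair x s) = 0 then v i (Suc l) (pair x s) else 0)"
    and diff: "\<And>l s. v False l s \<noteq> v True l s"
  shows "eqv K1 (Elem (v False 0 0)) (Elem (v True 0 0)) \<longleftrightarrow>
    \<not> (\<exists>z. \<forall>l. A (Suc l) (hist z (Suc l)) = 0)"
proof
  assume eqv: "eqv K1 (Elem (v False 0 0)) (Elem (v True 0 0))"
  show "\<not> (\<exists>z. \<forall>l. A (Suc l) (hist z (Suc l)) = 0)"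
  proof
    assume "\<exists>z. \<forall>l. A (Suc l) (hist z (Suc l)) = 0"
    then obtain z where z: "\<And>l. A (Suc l) (hist z (Suc l)) = 0" by blast
    \<comment> \<open>Stated for all terms with these values, because the derivation moves on to
      applications. Along the path the two values stay distinct, so no base case occurs.\<close>
    have False if "eqv K1 s t" "val K1 s = Some (v False l (hist z l))"
      "val K1 t = Some (v True l (hist z l))" for s t l
      using that
    proof (induction arbitrary: l rule: eqv.induct)
      case (eqv_base s t)
      then show ?case using diff by (simp add: kleene_eq_def)
    next
      case (eqv_step s t)
      show ?case
        by (rule eqv_step.IH[of "z l" "Suc l"])
          (use eqv_step.prems node z[of l] in auto)
    qed
    from this[OF eqv, of 0] show False by simp
  qed
next
  assume no_path: "\<not> (\<exists>z. \<forall>l. A (Suc l) (hist z (Suc l)) = 0)"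
  show "eqv K1 (Elem (v False 0 0)) (Elem (v True 0 0))"
  proof (rule ccontr)
    assume root: "\<not> eqv K1 (Elem (v False 0 0)) (Elem (v True 0 0))"
    \<comment> \<open>The condition at length 0 fixes the root as the empty history, so that the
      chosen nodes agree with \<open>hist z\<close>.\<close>
    define P where "P l s \<longleftrightarrow> \<not> eqv K1 (Elem (v False l s)) (Elem (v True l s)) \<and> (l = 0 \<longrightarrow> s = 0)" for l s
    have child: "\<exists>s'. P (Suc l) s' \<and> (\<exists>x. s' = pair x s \<and> A (Suc l) s' = 0)" if "P l s" for l s
    proof -
      have "\<not> eqv K1 (Elem (v False l s)) (Elem (v True l s))" using that by (simp add: P_def)
      then obtain x where x: "\<not> eqv K1 (App (Elem (v False l s)) (Elem x)) (App (Elem (v True l s)) (Elem x))"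
        by (metis eqv.eqv_step)
      \<comment> \<open>Off the tree both applications have the value 0 and would be Kleene
        equal.\<close>
      then have A: "A (Suc l) (pair x s) = 0"
        using node by (force intro!: eqv.eqv_base simp: kleene_eq_def)
      then have "\<not> eqv K1 (Elem (v False (Suc l) (pair x s))) (Elem (v True (Suc l) (pair x s)))"
        using x node by (auto elim!: eqv_cong contrapos_nn)
      then show ?thesis using A by (auto simp: P_def)
    qed
    have "\<exists>H. \<forall>l. P l (H l) \<and> (\<exists>x. H (Suc l) = pair x (H l) \<and> A (Suc l) (H (Suc l)) = 0)"
    proof (rule dependent_nat_choice)
      show "\<exists>s. P 0 s" using root by (auto simp: P_def)
    qed (rule child)
    then obtain H where H: "\<And>l. P l (H l)"
      "\<And>l. \<exists>x. H (Suc l) = pair x (H l) \<and> A (Suc l) (H (Suc l)) = 0"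
      by blast
    define z where "z l = pfst (H (Suc l))" for l
    have step: "H (Suc l) = pair (z l) (H l)" for l
      using H(2)[of l] by (auto simp: z_def)
    have "hist z l = H l" for l
    proof (induction l)
      case 0
      then show ?case using H(1)[of 0] by (simp add: P_def)
    qed (simp add: step)
    then show False using no_path H(2) by metis
  qed
qed

section \<open>The reduction to pairs of root elements\<close>

lemma Pi11_hard_eqv:
  assumes "Pi11 B"
  shows "many_one_reducible B {prod_encode (cterm_encode s, cterm_encode t) | s t. eqv K1 s t}"
proof -
  obtain F where F: "effective F" "\<And>n. n \<notin> B \<longleftrightarrow> (\<exists>h. \<forall>k. F h (pair n k) = 0)"
    using Pi11_normal_form[OF assms] by blast
  \<comment> \<open>A node is \<open>pair i (pair n (pair l s))\<close>: which of the two elements,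
    the instance, the length and the history. \<open>step\<close> keeps the first two and extends
    the rest by \<open>x\<close>.\<close>
  define c where "c w = alarm F (pfst (psnd w)) (psnd (psnd w))" for w
  define step where "step w x = pair (pfst w) (pair (pfst (psnd w))
    (pair (Suc (pfst (psnd (psnd w)))) (pair x (psnd (psnd (psnd w))))))" for w x
  have "computable c"
    unfolding c_def by (intro computable2_comp[OF computable2_alarm[OF F(1)]] computable_intros)
  moreover have "computable2 step"
    unfolding computable2_def step_def by (intro computable_intros)
  ultimately obtain v where v: "computable v" "inj v"
    "\<And>w x. Phi (v w) x = Some (if c (step w x) = 0 then v (step w x) else 0)"
    by (rule ex_node_codes) blast
  define node where "node n i l s = v (pair (of_bool i) (pair n (pair l s)))" for n i l s
  \<comment> \<open>Doubling is the code of \<open>Elem\<close>.\<close>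
  define h where "h n = pair (2 * node n False 0 0) (2 * node n True 0 0)" for n
  have "computable h"
    unfolding h_def node_def by (intro computable_intros computable_comp[OF v(1)])
  moreover have "n \<in> B \<longleftrightarrow> h n \<in> {prod_encode (cterm_encode s, cterm_encode t) | s t. eqv K1 s t}" for n
  proof -
    have "n \<in> B \<longleftrightarrow> \<not> (\<exists>z. \<forall>l. alarm F n (pair (Suc l) (hist z (Suc l))) = 0)"
      using F(2)[of n] path_iff[OF F(1), of n] by blast
    also have "\<dots> \<longleftrightarrow> eqv K1 (Elem (node n False 0 0)) (Elem (node n True 0 0))"
      by (rule eqv_iff_no_path[symmetric, where A = "\<lambda>l s. alarm F n (pair l s)"])
        (simp_all add: node_def v(3) c_def step_def inj_eq[OF v(2)])
    also have "\<dots> \<longleftrightarrow> h n \<in> {prod_encode (cterm_encode s, cterm_encode t) | s t. eqv K1 s t}"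
    proof -
      have "h n = prod_encode (cterm_encode (Elem (node n False 0 0)), cterm_encode (Elem (node n True 0 0)))"
        by (simp add: h_def)
      then show ?thesis
        by (auto dest: inj_cterm_encode simp del: cterm_encode.simps)
    qed
    finally show ?thesis .
  qed
  ultimately show ?thesis by (auto simp: many_one_reducible_def)
qed

theorem theorem5p7:
  assumes "infinite (UNIV :: 'o set)"
  shows "Pi11_complete
    {prod_encode (cterm_encode s, cterm_encode t) | s t. ext_equiv TYPE('o) K1 s t}"
  unfolding ext_equiv_iff_eqv[OF assms] Pi11_complete_def
  using Pi11_eqv Pi11_hard_eqv by blast

end
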